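(* Let $\Omega\subset\mathbb{R}^3$ be a domain exactly triangulated by a tetrahedral mesh $\Omega_h$ of elements $D^k$, let $V_h(D^k)$ be the space of polynomials of total degree at most $N$ on $D^k$, and let $V_h(\Omega_h)=\bigoplus_k V_h(D^k)$. Let the coefficient fields $\bm{Q}_s^{-1}(\bm{x})\in\mathbb{R}^{12\times 12}$, $\rho(\bm{x})\in\mathbb{R}$ and $\bm{S}(\bm{x})\in\mathbb{R}^{12\times12}$ satisfy the assumptions in the context: $\bm{Q}_s^{-1}$ and $\rho$ are pointwise bounded and (uniformly) positive definite, and $\bm{S}$ is pointwise bounded and negative semi-definite. Let the penalty parameters $\alpha_{\bm{\sigma}},\alpha_{\bm{v}}\ge 0$ be constant on each face. Let $\bm{\sigma}(t)\in V_h(\Omega_h)^{12}$ and $\bm{v}(t)\in V_h(\Omega_h)^3$, continuously differentiable in $t$, satisfy the following semi-discrete discontinuous Galerkin formulation without external forcing: for all $\bm{h}\in V_h(\Omega_h)^{12}$ and $\bm{g}\in V_h(\Omega_h)^{3}$ and all $t$, $$\sum_{D^k\in\Omega_h}\left(\bm{Q}_s^{-1}\frac{\partial\bm{\sigma}}{\partial t},\bm{h}\right)_{L^2(D^k)}=\sum_{D^k\in\Omega_h}\left[\left(\sum_{i=1}^{3}\bm{A}_i\frac{\partial\bm{v}}{\partial x_i},\bm{h}\right)_{L^2(D^k)}+\left\langle\frac12\bm{A}_n[\![\bm{v}]\!]+\frac{\alpha_{\bm{\sigma}}}{2}\bm{A}_n\bm{A}_n^T[\![\bm{\sigma}]\!],\bm{h}\right\rangle_{L^2(\partial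 D^k)}+(\bm{S}\bm{\sigma},\bm{h})_{L^2(D^k)}\right],$$ $$\sum_{D^k\in\Omega_h}\left(\rho\frac{\partial\bm{v}}{\partial t},\bm{g}\right)_{L^2(D^k)}=\sum_{D^k\in\Omega_h}\left[\left(\sum_{i=1}^{3}\bm{A}_i^T\frac{\partial\bm{\sigma}}{\partial x_i},\bm{g}\right)_{L^2(D^k)}+\left\langle\frac12\bm{A}_n^T[\![\bm{\sigma}]\!]+\frac{\alpha_{\bm{v}}}{2}\bm{A}_n^T\bm{A}_n[\![\bm{v}]\!],\bm{g}\right\rangle_{L^2(\partial D^k)}\right],$$ where on boundary faces the jumps are those prescribed in the context for free-surface faces (set $\Gamma_{\bm{\sigma}}$) and absorbing faces (set $\Gamma_{\mathrm{abc}}$), and every boundary face belongs to exactly one of these two sets. Then the formulation is energy stable in the sense that, for all $t$, $$\sum_{D^k\in\Omega_h}\frac12\frac{\partial}{\partial t}\Big((\bm{Q}_s^{-1}\bm{\sigma},\bm{\sigma})_{L^2(D^k)}+(\rho\bm{v},\bm{v})_{L^2(D^k)}\Big)$$ $$=-\sum_{f\in\Gamma_h\setminus\partial\Omega}\int_f\left(\frac{\alpha_{\bm{\sigma}}}{2}\big|\bm{A}_n^T[\![\bm{\sigma}]\!]\big|^2+\frac{\alpha_{\bm{v}}}{2}\big|\bm{A}_n[\![\bm{v}]\!]\big|^2\right)d\bm{x}-\sum_{f\in\Gamma_{\bm{\sigma}}}\int_f\alpha_{\bm{\sigma}}\big|\bm{A}_n^T\bm{\sigma}^-\big|^2\,d\bm{x}$$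 $$-\sum_{f\in\Gamma_{\mathrm{abc}}}\int_f\left(\frac{\alpha_{\bm{\sigma}}}{2}\big|\bm{A}_n^T\bm{\sigma}^-\big|^2+\frac{\alpha_{\bm{v}}}{2}\big|\bm{A}_n\bm{v}^-\big|^2\right)d\bm{x}+\sum_{D^k\in\Omega_h}\int_{D^k}\bm{\sigma}^T\bm{S}\bm{\sigma}\,d\bm{x}\;\le\;0,$$ where $\Gamma_h\setminus\partial\Omega$ denotes the set of interior faces (each counted once).
   Context: Unknowns. The formulation discretizes the first-order symmetric form of the 3D anisotropic viscoelastic wave equation $\bm{Q}_s^{-1}\partial_t\bm{\sigma}=\sum_{i=1}^3\bm{A}_i\,\partial_{x_i}\bm{v}+\bm{S}\bm{\sigma}$, $\rho\,\partial_t\bm{v}=\sum_{i=1}^3\bm{A}_i^T\,\partial_{x_i}\bm{\sigma}$ (no external force). Here $\bm{\sigma}=(\sigma_{11},\sigma_{22},\sigma_{33},\sigma_{23},\sigma_{13},\sigma_{12},a_1,\dots,a_6)^T$ collects six stress components and six (modified) memory variables, and $\bm{v}=(v_1,v_2,v_3)^T$ is the particle velocity. Matrices. $\bm{A}_1,\bm{A}_2,\bm{A}_3$ are the constant $12\times3$ matrices whose rows 7 to 12 vanish and whose only nonzero entries (all equal to 1) are at the positions (row, column): $\bm{A}_1$: $(1,1),(5,3),(6,2)$; $\bm{A}_2$: $(2,2),(4,3),(6,1)$; $\bm{A}_3$: $(3,3),(4,2),(5,1)$. On a face of an element with unit outward normal $\bm{n}=(n_1,n_2,n_3)$, $\bm{A}_n=\sum_{i=1}^3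 n_i\bm{A}_i$. Coefficients. All coefficient fields are measurable, independent of time, and may vary in space. $\bm{Q}_s^{-1}(\bm{x})$ is the block-diagonal matrix $\mathrm{diag}(\bm{C}_p^{-1}(\bm{x}),\bm{I}_{6})$, where $\bm{C}_p(\bm{x})$ is the symmetric $6\times 6$ matrix of unrelaxed elastic stiffnesses $$\bm{C}_p=\begin{pmatrix}c_{11}&c_{12}&c_{13}&0&0&0\\c_{12}&c_{22}&c_{13}&0&0&0\\c_{13}&c_{13}&c_{33}&0&0&0\\0&0&0&c_{44}&0&0\\0&0&0&0&c_{55}&0\\0&0&0&0&0&c_{66}\end{pmatrix}.$$ $\rho(\bm{x})$ is the scalar density. $\bm{S}(\bm{x})$ is the (not necessarily symmetric) $12\times 12$ matrix of zeroth-order relaxation terms. Assumptions: there are constants such that $0<\rho_{\min}\le\rho(\bm{x})\le\rho_{\max}<\infty$, and, for all unit vectors $\bm{u}\in\mathbb{R}^{12}$ and all $\bm{x}$, $0<c_{\min}\le\bm{u}^T\bm{Q}_s(\bm{x})\bm{u}\le c_{\max}<\infty$ and $0<\hat c_{\min}\le\bm{u}^T\bm{Q}_s^{-1}(\bm{x})\bm{u}\le\hat c_{\max}<\infty$; moreover $\bm{S}$ is bounded and $\bm{u}^T\bm{S}(\bm{x})\bm{u}\le 0$ for all $\bm{u}\in\mathbb{R}^{12}$ and all $\bm{x}$. Mesh and inner products. Each $D^k$ is the image of a reference tetrahedron under an affine map, and every interior face is shared by exactly two elements. $(\cdot,\cdot)_{L^2(D^k)}$ and $\langle\cdot,\cdot\rangle_{L^2(\partial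 D^k)}$ are the $L^2$ inner products of vector-valued functions over $D^k$ and over its boundary; in the latter, $\bm{n}$ is the outward unit normal of $D^k$ and test functions are evaluated by their trace from inside $D^k$. $\Gamma_h$ is the set of unique faces of the mesh. Jumps. On a face $f$ of $D^k$ shared with a neighbor $D^{k,+}$, $u^-$ is the trace of $u$ from $D^k$, $u^+$ the trace from $D^{k,+}$, and $[\![u]\!]=u^+-u^-$, componentwise for vectors. The penalty parameters $\alpha_{\bm{\sigma}},\alpha_{\bm{v}}$ take one constant value on each face, common to both adjacent elements. In the energy identity, for an interior face, $\bm{n}$ and the jumps are taken with respect to either of the two adjacent elements (the integrands do not depend on this choice). Boundary conditions. On boundary faces in $\Gamma_{\bm{\sigma}}$ (free surface) the jumps in the formulation are replaced by $\bm{A}_n^T[\![\bm{\sigma}]\!]:=-2\bm{A}_n^T\bm{\sigma}^-$ and $[\![\bm{v}]\!]:=0$. On boundary faces in $\Gamma_{\mathrm{abc}}$ (absorbing) they are replaced by $\bm{A}_n^T[\![\bm{\sigma}]\!]:=-\bm{A}_n^T\bm{\sigma}^-$ and $[\![\bm{v}]\!]:=-\bm{v}^-$. *)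

theory Defs
  imports "HOL-Analysis.Analysis"
begin

text \<open>
  The twelve components of \<sigma> are indexed by \<open>6 + 6\<close>: \<open>Inl 1, \<dots>, Inl 6\<close> are the stresses
  11, 22, 33, 23, 13, 12 and \<open>Inr 1, \<dots>, Inr 6\<close> are the memory variables. In the numeral types,
  \<open>(6::6) = 0\<close> and \<open>(3::3) = 0\<close>, so \<open>1, \<dots>, 6\<close> and \<open>1, 2, 3\<close> list all indices once.
\<close>

type_synonym point = "real^3"
type_synonym state_index = "6 + 6"

definition Amat :: "3 \<Rightarrow> real^3^state_index" where
  "Amat i = (\<chi> r c. if (r, c) \<in>
       (if i = 1 then {(Inl 1, 1), (Inl 5, 3), (Inl 6, 2)}
        else if i = 2 then {(Inl 2, 2), (Inl 4, 3), (Inl 6, 1)}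
        else {(Inl 3, 3), (Inl 4, 2), (Inl 5, 1)}) then 1 else 0)"

definition An :: "point \<Rightarrow> real^3^state_index" where
  "An n = (\<Sum>i\<in>UNIV. n $ i *\<^sub>R Amat i)"

definition stiffness ::
  "real \<Rightarrow> real \<Rightarrow> real \<Rightarrow> real \<Rightarrow> real \<Rightarrow> real \<Rightarrow> real \<Rightarrow> real \<Rightarrow> real^6^6" where
  "stiffness c11 c12 c13 c22 c33 c44 c55 c66 = vector
     [vector [c11, c12, c13, 0, 0, 0],
      vector [c12, c22, c13, 0, 0, 0],
      vector [c13, c13, c33, 0, 0, 0],
      vector [0, 0, 0, c44, 0, 0],
      vector [0, 0, 0, 0, c55, 0],
      vector [0, 0, 0, 0, 0, c66]]"

definition block_diag :: "real^'a^'a \<Rightarrow> real^'b^'b \<Rightarrow> real^('a + 'b)^('a + 'b)" where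
  "block_diag M N = (\<chi> i j. case (i, j) of
       (Inl a, Inl b) \<Rightarrow> M $ a $ b
     | (Inr a, Inr b) \<Rightarrow> N $ a $ b
     | _ \<Rightarrow> 0)"

definition Qs :: "real^6^6 \<Rightarrow> real^state_index^state_index" where
  "Qs C = block_diag C (mat 1)"

definition Qs_inv :: "real^6^6 \<Rightarrow> real^state_index^state_index" where
  "Qs_inv C = block_diag (matrix_inv C) (mat 1)"

definition uniformly_pos_def_on :: "'x set \<Rightarrow> ('x \<Rightarrow> real^'n^'n) \<Rightarrow> bool" where
  "uniformly_pos_def_on X M \<longleftrightarrow>
     (\<exists>lo hi. 0 < lo \<and> (\<forall>x\<in>X. \<forall>u. norm u = 1 \<longrightarrow> lo \<le> u \<bullet> (M x *v u) \<and> u \<bullet> (M x *v u) \<le> hi))"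

definition admissible_coefficients ::
  "point set \<Rightarrow> (point \<Rightarrow> real^6^6) \<Rightarrow> (point \<Rightarrow> real) \<Rightarrow>
   (point \<Rightarrow> real^state_index^state_index) \<Rightarrow> bool" where
  "admissible_coefficients \<Omega> Cp \<rho> S \<longleftrightarrow>
     (\<lambda>x. Qs_inv (Cp x)) \<in> borel_measurable (lebesgue_on \<Omega>) \<and>
     \<rho> \<in> borel_measurable (lebesgue_on \<Omega>) \<and>
     S \<in> borel_measurable (lebesgue_on \<Omega>) \<and>
     (\<forall>x\<in>\<Omega>. \<exists>c11 c12 c13 c22 c33 c44 c55 c66.
        Cp x = stiffness c11 c12 c13 c22 c33 c44 c55 c66) \<and>
     uniformly_pos_def_on \<Omega> (\<lambda>x. Qs (Cp x)) \<and>
     uniformly_pos_def_on \<Omega> (\<lambda>x. Qs_inv (Cp x)) \<and>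
     (\<exists>\<rho>min \<rho>max. 0 < \<rho>min \<and> (\<forall>x\<in>\<Omega>. \<rho>min \<le> \<rho> x \<and> \<rho> x \<le> \<rho>max)) \<and>
     bounded (S ` \<Omega>) \<and>
     (\<forall>x\<in>\<Omega>. \<forall>u. u \<bullet> (S x *v u) \<le> 0)"

definition mesh_faces :: "point set set \<Rightarrow> point set set" where
  "mesh_faces \<T> = {F. \<exists>D\<in>\<T>. F facet_of D}"

definition tetrahedral_mesh :: "point set \<Rightarrow> point set set \<Rightarrow> bool" where
  "tetrahedral_mesh \<Omega> \<T> \<longleftrightarrow>
     finite \<T> \<and>
     (\<forall>D\<in>\<T>. 3 simplex D \<and> interior D \<subseteq> \<Omega>) \<and>
     \<Union>\<T> = closure \<Omega> \<and>
     (\<forall>D\<in>\<T>. \<forall>D'\<in>\<T>. D \<noteq> D' \<longrightarrow> interior D \<inter> interior D' = {}) \<and>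
     (\<forall>F\<in>mesh_faces \<T>. card {D\<in>\<T>. F facet_of D} = (if F \<subseteq> frontier \<Omega> then 1 else 2))"

definition boundary_faces :: "point set \<Rightarrow> point set set \<Rightarrow> point set set" where
  "boundary_faces \<Omega> \<T> = {F\<in>mesh_faces \<T>. F \<subseteq> frontier \<Omega>}"

definition outward_normal :: "point set \<Rightarrow> point set \<Rightarrow> point" where
  "outward_normal D F = (THE n. norm n = 1 \<and> (\<forall>x\<in>F. \<forall>y\<in>D. n \<bullet> y \<le> n \<bullet> x))"

definition neighbor :: "point set set \<Rightarrow> point set \<Rightarrow> point set \<Rightarrow> point set" where
  "neighbor \<T> D F = (THE D'. D' \<in> \<T> \<and> D' \<noteq> D \<and> F facet_of D')"

definition vol_inner :: "point set \<Rightarrow> (point \<Rightarrow> 'a::euclidean_space) \<Rightarrow> (point \<Rightarrow> 'a) \<Rightarrow> real" where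
  "vol_inner D f g = (LINT x:D|lebesgue. f x \<bullet> g x)"

text \<open>
  The surface integral over a triangle with vertices \<open>a, b, c\<close>, computed in the affine
  parametrization over the unit triangle. For a triangle \<open>F\<close> the condition on \<open>a, b, c\<close> determines them up to
  their order, which does not affect the value.
\<close>

definition face_integral :: "point set \<Rightarrow> (point \<Rightarrow> real) \<Rightarrow> real" where
  "face_integral F g =
     (let (a, b, c) = (SOME (a, b, c). F = convex hull {a, b, c}) in
        norm (cross3 (b - a) (c - a)) *
        (LINT p:{(s, t). 0 \<le> s \<and> 0 \<le> t \<and> s + t \<le> 1}|lborel.
           g (a + fst p *\<^sub>R (b - a) + snd p *\<^sub>R (c - a))))"

definition bdry_inner ::
  "point set \<Rightarrow> (point set \<Rightarrow> point \<Rightarrow> 'a::euclidean_space) \<Rightarrow> (point \<Rightarrow> 'a) \<Rightarrow> real" where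
  "bdry_inner D \<phi> g = (\<Sum>F\<in>{F. F facet_of D}. face_integral F (\<lambda>x. \<phi> F x \<bullet> g x))"

text \<open>
  A broken field assigns to each element its own function. A polynomial on an element is
  represented by its unique polynomial extension to the whole space, so \<open>u D x\<close> for \<open>x\<close> on a
  face of \<open>D\<close> is the trace from inside \<open>D\<close>.
\<close>

type_synonym 'a broken = "point set \<Rightarrow> point \<Rightarrow> 'a"

definition poly_deg_le :: "nat \<Rightarrow> (point \<Rightarrow> real) set" where
  "poly_deg_le N = {p. \<exists>a :: nat^3 \<Rightarrow> real.
     p = (\<lambda>x. \<Sum>m\<in>{m. (\<Sum>i\<in>UNIV. m $ i) \<le> N}. a m * (\<Prod>i\<in>UNIV. x $ i ^ (m $ i)))}"

definition Vh :: "nat \<Rightarrow> point set set \<Rightarrow> (real^'m) broken set" where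
  "Vh N \<T> = {u. \<forall>D\<in>\<T>. \<forall>j. (\<lambda>x. u D x $ j) \<in> poly_deg_le N}"

definition partial :: "3 \<Rightarrow> (point \<Rightarrow> 'a::real_normed_vector) \<Rightarrow> point \<Rightarrow> 'a" where
  "partial i f x = frechet_derivative f (at x) (axis i 1)"

definition C1_in_time ::
  "real set \<Rightarrow> point set set \<Rightarrow> (real \<Rightarrow> 'a::real_normed_vector broken) \<Rightarrow> bool" where
  "C1_in_time J \<T> u \<longleftrightarrow>
     (\<forall>D\<in>\<T>. \<forall>x\<in>D. \<exists>u'. continuous_on J u' \<and>
        (\<forall>t\<in>J. ((\<lambda>s. u s D x) has_vector_derivative u' t) (at t within J)))"

definition time_deriv ::
  "real set \<Rightarrow> (real \<Rightarrow> 'a::real_normed_vector broken) \<Rightarrow> real \<Rightarrow> 'a broken" where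
  "time_deriv J u t D x = vector_derivative (\<lambda>s. u s D x) (at t within J)"

definition jump :: "point set set \<Rightarrow> 'a::minus broken \<Rightarrow> point set \<Rightarrow> point set \<Rightarrow> point \<Rightarrow> 'a" where
  "jump \<T> u D F x = u (neighbor \<T> D F) x - u D x"

text \<open>
  \<open>jump_An_sigma\<close> is \<open>A\<^sub>n\<^sup>T\<lbrakk>\<sigma>\<rbrakk>\<close> and \<open>jump_v\<close> is \<open>\<lbrakk>v\<rbrakk>\<close>, on the face \<open>F\<close> seen from \<open>D\<close>, including the
  values prescribed on free-surface faces \<open>\<Gamma>s\<close> and absorbing faces \<open>\<Gamma>abc\<close>.
\<close>

definition jump_An_sigma ::
  "point set set \<Rightarrow> point set set \<Rightarrow> point set set \<Rightarrow> (real^state_index) broken \<Rightarrow>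
   point set \<Rightarrow> point set \<Rightarrow> point \<Rightarrow> real^3" where
  "jump_An_sigma \<T> \<Gamma>s \<Gamma>abc \<sigma> D F x =
     (let AnT = transpose (An (outward_normal D F)) in
        if F \<in> \<Gamma>s then - 2 *\<^sub>R (AnT *v \<sigma> D x)
        else if F \<in> \<Gamma>abc then - (AnT *v \<sigma> D x)
        else AnT *v jump \<T> \<sigma> D F x)"

definition jump_v ::
  "point set set \<Rightarrow> point set set \<Rightarrow> point set set \<Rightarrow> (real^3) broken \<Rightarrow>
   point set \<Rightarrow> point set \<Rightarrow> point \<Rightarrow> real^3" where
  "jump_v \<T> \<Gamma>s \<Gamma>abc v D F x =
     (if F \<in> \<Gamma>s then 0
      else if F \<in> \<Gamma>abc then - v D x
      else jump \<T> v D F x)"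

definition flux_sigma ::
  "point set set \<Rightarrow> point set set \<Rightarrow> point set set \<Rightarrow> (point set \<Rightarrow> real) \<Rightarrow>
   (real^state_index) broken \<Rightarrow> (real^3) broken \<Rightarrow>
   point set \<Rightarrow> point set \<Rightarrow> point \<Rightarrow> real^state_index" where
  "flux_sigma \<T> \<Gamma>s \<Gamma>abc \<alpha>s \<sigma> v D F x =
     (1/2) *\<^sub>R (An (outward_normal D F) *v jump_v \<T> \<Gamma>s \<Gamma>abc v D F x) +
     (\<alpha>s F / 2) *\<^sub>R (An (outward_normal D F) *v jump_An_sigma \<T> \<Gamma>s \<Gamma>abc \<sigma> D F x)"

definition flux_v ::
  "point set set \<Rightarrow> point set set \<Rightarrow> point set set \<Rightarrow> (point set \<Rightarrow> real) \<Rightarrow>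
   (real^state_index) broken \<Rightarrow> (real^3) broken \<Rightarrow>
   point set \<Rightarrow> point set \<Rightarrow> point \<Rightarrow> real^3" where
  "flux_v \<T> \<Gamma>s \<Gamma>abc \<alpha>v \<sigma> v D F x =
     (1/2) *\<^sub>R jump_An_sigma \<T> \<Gamma>s \<Gamma>abc \<sigma> D F x +
     (\<alpha>v F / 2) *\<^sub>R (transpose (An (outward_normal D F)) *v
                      (An (outward_normal D F) *v jump_v \<T> \<Gamma>s \<Gamma>abc v D F x))"

end

theory Submission
  imports Defs
begin

text \<open>
  Testing the two equations with \<open>\<sigma>\<close> and \<open>v\<close> themselves gives half the time derivative of the energy,
  because \<open>Q\<^sub>s\<^sup>-\<^sup>1\<close> and \<open>\<rho>\<close> are symmetric. The two volume terms add up to the divergence of the field with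
  components \<open>(A\<^sub>i v) \<bullet> \<sigma>\<close>, so they become the face terms \<open>(A\<^sub>n v) \<bullet> \<sigma>\<close>. On an interior face the two
  outward normals are opposite; there the central part of the flux cancels against these terms and the
  penalty part leaves the two squares. On boundary faces the prescribed jumps do the same pointwise.

  The divergence theorem on a tetrahedron is linear in the direction, hence needed only along the three
  edges from one vertex: along such an edge, Fubini and the fundamental theorem of calculus in affine
  coordinates give the two faces that do not contain the edge. Pointwise differentiability in time gives
  differentiability of the energy because a polynomial of bounded degree is a fixed linear combination
  of finitely many of its point values.
\<close>

section \<open>Facets and outward normals of tetrahedra\<close>

text \<open>The coefficient hypotheses hold on the open set \<open>\<Omega>\<close>, whereas
  elements are closed and a boundary face lies outside \<open>\<Omega>\<close>. Hence measurability,
  symmetry and sign of the coefficients are used on \<open>interior D\<close> only and carried over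
  to \<open>D\<close> across the null set \<open>frontier D\<close>. Normals, neighbors and the
  vertices of a face are given by description or choice operators, so existence, uniqueness or
  independence of the choice has to be settled before a formula can be evaluated. On each element a
  broken field is a polynomial on the whole space, which is why regularity is stated on
  \<open>UNIV\<close> and traces need no limits. Fubini lives on products of the reals, the mesh in
  \<open>real^3\<close>; a measure isomorphism and a linear change of variables connect them. The
  resulting factor is the triple product of three edges, which equals twice the area of any face
  times the height over it; this is how volume and face integrals acquire the same constant.\<close>

definition tetra :: "point \<Rightarrow> point \<Rightarrow> point \<Rightarrow> point \<Rightarrow> bool" where
  "tetra a b c d \<longleftrightarrow> \<not> affine_dependent {a, b, c, d} \<and> card {a, b, c, d} = 4"

text \<open>Adjacent transpositions generate all orderings of the vertices, so every fact below is
  proved for one distinguished vertex or edge and transferred by these rules.\<close>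

lemma tetra_perm:
  assumes "tetra a b c d"
  shows "tetra b a c d" "tetra a c b d" "tetra a b d c"
  using assms unfolding tetra_def by (simp_all add: insert_commute)

lemma tetra_distinct:
  assumes "tetra a b c d"
  shows "a \<noteq> b" "a \<noteq> c" "a \<noteq> d" "b \<noteq> c" "b \<noteq> d" "c \<noteq> d"
  using assms unfolding tetra_def by (auto simp: card_insert_if split: if_splits)

text \<open>Affine independence of the vertices is linear independence of the edges from
  \<open>a\<close>, and three independent vectors span a space of dimension three.\<close>

lemma tetra_edges_span:
  assumes "tetra a b c d"
  shows "span {b - a, c - a, d - a} = UNIV"
proof -
  have eq: "(\<lambda>x. -a + x) ` ({a, b, c, d} - {a}) = {b - a, c - a, d - a}"
    using tetra_distinct[OF assms] by auto
  have "independent {b - a, c - a, d - a}"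
    using assms affine_dependent_iff_dependent2[of a "{a, b, c, d}"] eq
    unfolding tetra_def by auto
  moreover have "card {b - a, c - a, d - a} = 3"
    using tetra_distinct[OF assms] by auto
  ultimately have "dim {b - a, c - a, d - a} = DIM(point)"
    by (simp add: dim_eq_card_independent)
  then show ?thesis by (rule dim_eq_full[THEN iffD1])
qed

lemma tetra_orthogonal_edges_eq_0:
  assumes "tetra a b c d"
    and "w \<bullet> (b - a) = 0" "w \<bullet> (c - a) = 0" "w \<bullet> (d - a) = 0"
  shows "w = 0"
proof -
  have "orthogonal w w"
    using tetra_edges_span[OF assms(1)] assms(2-)
    by (intro orthogonal_to_span[of w "{b - a, c - a, d - a}"]) (auto simp: orthogonal_def)
  then show ?thesis by (simp add: orthogonal_def)
qed

lemma three_simplex_tetra: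
  assumes "3 simplex D"
  obtains a b c d where "tetra a b c d" "D = convex hull {a, b, c, d}"
proof -
  obtain C where C: "\<not> affine_dependent C" "card C = 4" "D = convex hull C"
    using assms unfolding simplex_def by auto
  obtain a b c d where "C = {a, b, c, d}"
  proof -
    have "card C = Suc (Suc (Suc (Suc 0)))" using C by simp
    then show thesis by (auto simp: card_Suc_eq intro: that)
  qed
  with C show thesis by (intro that) (auto simp: tetra_def)
qed

lemma facet_of_tetra:
  assumes "tetra a b c d"
  shows "F facet_of convex hull {a, b, c, d} \<longleftrightarrow>
     F \<in> {convex hull {b, c, d}, convex hull {a, c, d}, convex hull {a, b, d}, convex hull {a, b, c}}"
proof -
  have "{a, b, c, d} - {a} = {b, c, d}" "{a, b, c, d} - {b} = {a, c, d}"
    "{a, b, c, d} - {c} = {a, b, d}" "{a, b, c, d} - {d} = {a, b, c}"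
    using tetra_distinct[OF assms] by auto
  moreover have "F facet_of convex hull {a, b, c, d} \<longleftrightarrow>
      (\<exists>u\<in>{a, b, c, d}. F = convex hull ({a, b, c, d} - {u}))"
    using assms unfolding tetra_def
    by (subst facet_of_convex_hull_affine_independent_alt) auto
  ultimately show ?thesis
    by (simp only: bex_simps insert_iff empty_iff)
qed

text \<open>Renaming the vertices puts the one opposite to \<open>F\<close> first, so that normals
  have to be studied for a single face only.\<close>

lemma three_simplex_facet:
  assumes "3 simplex D" "F facet_of D"
  obtains a b c d where "tetra a b c d" "D = convex hull {a, b, c, d}" "F = convex hull {b, c, d}"
proof -
  obtain a b c d where t: "tetra a b c d" and D: "D = convex hull {a, b, c, d}"
    using three_simplex_tetra[OF assms(1)] by blast
  consider "F = convex hull {b, c, d}" | "F = convex hull {a, c, d}"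
    | "F = convex hull {a, b, d}" | "F = convex hull {a, b, c}"
    using facet_of_tetra[OF t] assms(2) D by auto
  then show thesis
  proof cases
    case 1 then show thesis using t D that by blast
  next
    case 2
    have "tetra b a c d" using t tetra_perm by blast
    with 2 show thesis using D that[of b a c d] by (simp add: insert_commute)
  next
    case 3
    have "tetra c a b d" using t tetra_perm by blast
    with 3 show thesis using D that[of c a b d] by (simp add: insert_commute)
  next
    case 4
    have "tetra d a b c" using t tetra_perm by blast
    with 4 show thesis using D that[of d a b c] by (simp add: insert_commute)
  qed
qed

text \<open>The vertices of an affinely independent hull are its extreme points, so equal hulls have
  equal vertex sets. Sums over facets range over a set of faces; splitting them into four summands
  requires the faces to differ.\<close>

lemma tetra_facets_distinct:
  assumes "tetra a b c d"
  shows "convex hull {b, c, d} \<noteq> convex hull {a, c, d}"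
proof
  assume eq: "convex hull {b, c, d} = convex hull {a, c, d}"
  have "\<not> affine_dependent {b, c, d}" "\<not> affine_dependent {a, c, d}"
    using affine_independent_subset[of "{a, b, c, d}" "{b, c, d}"]
      affine_independent_subset[of "{a, b, c, d}" "{a, c, d}"] assms
    unfolding tetra_def by (simp_all add: subset_insertI)
  then have "{b, c, d} = {a, c, d}"
    using eq by (metis extreme_point_of_convex_hull_affine_independent set_eqI)
  then show False using tetra_distinct[OF assms] by blast
qed

text \<open>This is the condition under the description operator in \<open>outward_normal\<close>,
  named so that existence and uniqueness can be proved for it.\<close>

definition is_outward_normal :: "point set \<Rightarrow> point set \<Rightarrow> point \<Rightarrow> bool" where
  "is_outward_normal D F n \<longleftrightarrow> norm n = 1 \<and> (\<forall>x\<in>F. \<forall>y\<in>D. n \<bullet> y \<le> n \<bullet> x)"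

text \<open>Points of the face also belong to the element, so the inequality holds in both
  directions between them and \<open>n\<close> is constant on the face. Equality at \<open>a\<close>
  as well would make \<open>n\<close> orthogonal to all edges, hence zero.\<close>

lemma is_outward_normal_tetra:
  assumes t: "tetra a b c d"
    and n: "is_outward_normal (convex hull {a, b, c, d}) (convex hull {b, c, d}) n"
  shows "norm n = 1" "n \<bullet> b = n \<bullet> c" "n \<bullet> b = n \<bullet> d" "n \<bullet> a < n \<bullet> b"
proof -
  have in_F: "b \<in> convex hull {b, c, d}" "c \<in> convex hull {b, c, d}" "d \<in> convex hull {b, c, d}"
    by (simp_all add: hull_inc)
  have in_D: "a \<in> convex hull {a, b, c, d}" "b \<in> convex hull {a, b, c, d}"
    "c \<in> convex hull {a, b, c, d}" "d \<in> convex hull {a, b, c, d}"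
    by (simp_all add: hull_inc)
  show n1: "norm n = 1" using n by (simp add: is_outward_normal_def)
  have le: "n \<bullet> y \<le> n \<bullet> x" if "x \<in> convex hull {b, c, d}" "y \<in> convex hull {a, b, c, d}" for x y
    using n that by (auto simp: is_outward_normal_def)
  show bc: "n \<bullet> b = n \<bullet> c" and bd: "n \<bullet> b = n \<bullet> d"
    using le in_F in_D by (meson order_antisym)+
  have "n \<bullet> a \<le> n \<bullet> b" using le in_F in_D by blast
  moreover have "n \<bullet> a \<noteq> n \<bullet> b"
  proof
    assume "n \<bullet> a = n \<bullet> b"
    then have "n = 0"
      using bc bd by (intro tetra_orthogonal_edges_eq_0[OF t]) (simp_all add: inner_diff_right)
    with n1 show False by simp
  qed
  ultimately show "n \<bullet> a < n \<bullet> b" by simp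
qed

lemma is_outward_normal_unique:
  assumes "3 simplex D" "F facet_of D" "is_outward_normal D F n" "is_outward_normal D F m"
  shows "n = m"
proof -
  obtain a b c d where t: "tetra a b c d" and D: "D = convex hull {a, b, c, d}"
    and F: "F = convex hull {b, c, d}"
    using three_simplex_facet[OF assms(1,2)] by blast
  note N = is_outward_normal_tetra[OF t assms(3)[unfolded D F]]
  note M = is_outward_normal_tetra[OF t assms(4)[unfolded D F]]
  \<comment> \<open>The ratio of the increases of \<open>n\<close> and \<open>m\<close> from
    \<open>a\<close> to the face; with it \<open>n - k *\<^sub>R m\<close> is orthogonal to all
    edges from \<open>a\<close>. Positivity and the unit norms then force
    \<open>k = 1\<close>.\<close>
  define k where "k = (n \<bullet> b - n \<bullet> a) / (m \<bullet> b - m \<bullet> a)"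
  have k0: "k > 0" using N M by (simp add: k_def)
  have km: "k * (m \<bullet> b - m \<bullet> a) = n \<bullet> b - n \<bullet> a" using M by (simp add: k_def)
  have "n - k *\<^sub>R m = 0"
  proof (rule tetra_orthogonal_edges_eq_0[OF t])
    show "(n - k *\<^sub>R m) \<bullet> (b - a) = 0" 
      using km by (simp add: inner_diff_left inner_diff_right algebra_simps)
    show "(n - k *\<^sub>R m) \<bullet> (c - a) = 0" 
      using km N(2) M(2) by (simp add: inner_diff_left inner_diff_right algebra_simps)
    show "(n - k *\<^sub>R m) \<bullet> (d - a) = 0" 
      using km N(3) M(3) by (simp add: inner_diff_left inner_diff_right algebra_simps)
  qed
  then have nk: "n = k *\<^sub>R m" by simp
  then have "k = 1" using N(1) M(1) k0 by simp
  with nk show ?thesis by simp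
qed

lemma is_outward_normal_exists:
  assumes "3 simplex D" "F facet_of D"
  shows "\<exists>n. is_outward_normal D F n"
proof -
  obtain a b c d where t: "tetra a b c d" and D: "D = convex hull {a, b, c, d}"
    and F: "F = convex hull {b, c, d}"
    using three_simplex_facet[OF assms(1,2)] by blast
  \<comment> \<open>Two edges of the face span at most a plane, which leaves a nonzero vector
    orthogonal to the face. Its sign is fixed afterwards by the side on which \<open>a\<close>
    lies.\<close>
  have "dim {c - b, d - b} \<le> card {c - b, d - b}" by (rule dim_le_card) (auto simp: span_superset)
  also have "\<dots> \<le> 2" by (simp add: card_insert_if)
  finally have "dim {c - b, d - b} < DIM(point)" by simp
  then obtain w where w: "w \<noteq> 0" "\<And>x. x \<in> span {c - b, d - b} \<Longrightarrow> orthogonal w x"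
    using orthogonal_to_subspace_exists[of "{c - b, d - b}"] by blast
  have wc: "w \<bullet> c = w \<bullet> b" and wd: "w \<bullet> d = w \<bullet> b"
    using w(2)[of "c - b"] w(2)[of "d - b"]
    by (auto simp: orthogonal_def span_base inner_diff_right)
  define n where "n = (if w \<bullet> a \<le> w \<bullet> b then inverse (norm w) *\<^sub>R w else - (inverse (norm w) *\<^sub>R w))"
  have n1: "norm n = 1" using w(1) by (simp add: n_def)
  have nb: "n \<bullet> c = n \<bullet> b" "n \<bullet> d = n \<bullet> b" using wc wd by (auto simp: n_def)
  have na: "n \<bullet> a \<le> n \<bullet> b" using w(1) by (auto simp: n_def field_simps)
  have "convex hull {b, c, d} \<subseteq> {x. n \<bullet> x = n \<bullet> b}"
    using nb by (intro hull_minimal) (auto simp: convex_hyperplane)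
  moreover have "convex hull {a, b, c, d} \<subseteq> {x. n \<bullet> x \<le> n \<bullet> b}"
    using nb na by (intro hull_minimal) (auto simp: convex_halfspace_le)
  ultimately have "is_outward_normal D F n"
    using n1 unfolding is_outward_normal_def D F by force
  then show ?thesis by blast
qed

lemma outward_normal_eqI:
  assumes "3 simplex D" "F facet_of D" "is_outward_normal D F n"
  shows "outward_normal D F = n"
  unfolding outward_normal_def is_outward_normal_def[symmetric]
  using is_outward_normal_unique[OF assms(1,2)] assms(3) by blast

lemma is_outward_normal_outward_normal:
  assumes "3 simplex D" "F facet_of D"
  shows "is_outward_normal D F (outward_normal D F)"
  using is_outward_normal_exists[OF assms] outward_normal_eqI[OF assms] by metis

lemma three_simplex_props:
  fixes D :: "point set"
  assumes "3 simplex D"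
  shows "compact D" "convex D" "closure (interior D) = D" "interior D \<noteq> {}"
proof -
  show c: "compact D" "convex D" using assms by (auto simp: compact_simplex convex_simplex)
  have "aff_dim D = DIM(point)" using aff_dim_simplex[OF assms] by simp
  then show i: "interior D \<noteq> {}"
    using rel_interior_eq_empty[OF c(2)] by (auto simp: interior_rel_interior_gen)
  show "closure (interior D) = D"
    using c i convex_closure_interior compact_imp_closed closure_closed by metis
qed

text \<open>A hyperplane separating the disjoint interiors also separates their closures, which are
  the elements. The common facet lies on both sides, hence in the hyperplane, so the normalized
  \<open>w\<close> and its negative satisfy the two conditions for an outward normal.\<close>

lemma outward_normal_opposite:
  assumes D1: "3 simplex D1" "F facet_of D1" and D2: "3 simplex D2" "F facet_of D2"
    and disj: "interior D1 \<inter> interior D2 = {}"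
  shows "outward_normal D2 F = - outward_normal D1 F"
proof -
  obtain w k where w: "w \<noteq> 0" "\<And>x. x \<in> interior D1 \<Longrightarrow> w \<bullet> x \<le> k"
      "\<And>x. x \<in> interior D2 \<Longrightarrow> w \<bullet> x \<ge> k"
    using separating_hyperplane_sets[of "interior D1" "interior D2"] disj
      three_simplex_props[OF D1(1)] three_simplex_props[OF D2(1)] convex_interior
    by (metis (no_types, lifting))
  have "closure (interior D1) \<subseteq> {x. w \<bullet> x \<le> k}"
    using w by (intro closure_minimal) (auto simp: closed_halfspace_le)
  then have le: "w \<bullet> x \<le> k" if "x \<in> D1" for x
    using that three_simplex_props[OF D1(1)] by auto
  have "closure (interior D2) \<subseteq> {x. w \<bullet> x \<ge> k}"
    using w by (intro closure_minimal) (auto simp: closed_halfspace_ge)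
  then have ge: "w \<bullet> x \<ge> k" if "x \<in> D2" for x
    using that three_simplex_props[OF D2(1)] by auto
  have F: "F \<subseteq> D1" "F \<subseteq> D2" using D1 D2 by (auto simp: facet_of_imp_subset)
  have eq: "w \<bullet> x = k" if "x \<in> F" for x using le ge F that by (meson order_antisym subsetD)
  define n where "n = inverse (norm w) *\<^sub>R w"
  have "is_outward_normal D1 F n" "is_outward_normal D2 F (- n)"
    using w(1) le ge eq by (auto simp: is_outward_normal_def n_def intro!: mult_left_mono)
  then show ?thesis
    using outward_normal_eqI D1 D2 by metis
qed

text \<open>Base times height: the first factor is twice the area of the face opposite to
  \<open>a\<close>, the second is the height of \<open>a\<close> over it, and the right-hand side is
  six times the volume.\<close>

lemma norm_cross3_mult_outward_normal:
  assumes t: "tetra a b c d"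
  defines "n \<equiv> outward_normal (convex hull {a, b, c, d}) (convex hull {b, c, d})"
  shows "norm (cross3 (c - b) (d - b)) * (n \<bullet> (b - a)) = \<bar>(b - a) \<bullet> cross3 (c - a) (d - a)\<bar>"
    and "n \<bullet> (c - b) = 0" and "n \<bullet> (d - b) = 0"
proof -
  have D: "3 simplex (convex hull {a, b, c, d})"
    using t unfolding tetra_def simplex_def by auto
  have F: "convex hull {b, c, d} facet_of convex hull {a, b, c, d}"
    using facet_of_tetra[OF t] by blast
  note N = is_outward_normal_tetra[OF t is_outward_normal_outward_normal[OF D F], folded n_def]
  define z where "z = cross3 (c - b) (d - b)"
  show nc: "n \<bullet> (c - b) = 0" and nd: "n \<bullet> (d - b) = 0" using N by (auto simp: inner_diff_right)
  \<comment> \<open>Expanding the double product gives multiples of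
    \<open>n \<bullet> (c - b)\<close> and \<open>n \<bullet> (d - b)\<close>, both zero. Applying
    \<open>cross3 n\<close> once more and expanding again shows that \<open>z\<close> is a multiple
    of the unit vector \<open>n\<close>.\<close>
  have "cross3 n z = 0"
    unfolding z_def Lagrange using nc nd by simp
  then have "cross3 n (cross3 n z) = 0" by simp
  then have z: "z = (n \<bullet> z) *\<^sub>R n"
    unfolding Lagrange[of n n z] using N(1) by (simp add: dot_square_norm)
  have "norm z = norm ((n \<bullet> z) *\<^sub>R n)" using z by (rule arg_cong)
  also have "\<dots> = \<bar>n \<bullet> z\<bar>" using N(1) by simp
  finally have nz: "norm z = \<bar>n \<bullet> z\<bar>" .
  have "(b - a) \<bullet> cross3 (c - a) (d - a) = (b - a) \<bullet> z"
    unfolding z_def by (simp add: cross3_simps)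
  also have "\<dots> = (n \<bullet> z) * (n \<bullet> (b - a))"
    by (subst z) (simp add: inner_commute)
  finally show "norm (cross3 (c - b) (d - b)) * (n \<bullet> (b - a)) = \<bar>(b - a) \<bullet> cross3 (c - a) (d - a)\<bar>"
    using N(4) nz unfolding z_def[symmetric] by (simp add: abs_mult inner_diff_right)
qed

section \<open>Integration over triangles and tetrahedra\<close>

definition unit_triangle :: "(real \<times> real) set" where
  "unit_triangle = {(s, t). 0 \<le> s \<and> 0 \<le> t \<and> s + t \<le> 1}"

definition unit_tetrahedron :: "(real \<times> real \<times> real) set" where
  "unit_tetrahedron = {(r, s, t). 0 \<le> r \<and> 0 \<le> s \<and> 0 \<le> t \<and> r + s + t \<le> 1}"

lemma compact_unit_triangle: "compact unit_triangle"
proof -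
  have "unit_triangle = {p. 0 \<le> fst p} \<inter> {p. 0 \<le> snd p} \<inter> {p. fst p + snd p \<le> 1}"
    by (auto simp: unit_triangle_def)
  moreover have "closed \<dots>"
    by (intro closed_Int closed_Collect_le continuous_intros)
  moreover have "unit_triangle \<subseteq> {0..1} \<times> {0..1}"
    by (auto simp: unit_triangle_def)
  ultimately show ?thesis
    by (metis bounded_Times bounded_closed_interval bounded_subset compact_eq_bounded_closed
        interval_cbox cbox_interval bounded_cbox)
qed

lemma compact_unit_tetrahedron: "compact unit_tetrahedron"
proof -
  have "unit_tetrahedron = {p. 0 \<le> fst p} \<inter> {p. 0 \<le> fst (snd p)} \<inter> {p. 0 \<le> snd (snd p)}
      \<inter> {p. fst p + fst (snd p) + snd (snd p) \<le> 1}"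
    by (auto simp: unit_tetrahedron_def)
  moreover have "closed \<dots>"
    by (intro closed_Int closed_Collect_le continuous_intros)
  moreover have "unit_tetrahedron \<subseteq> cbox 0 1 \<times> (cbox 0 1 \<times> cbox 0 1)"
    by (auto simp: unit_tetrahedron_def)
  moreover have "bounded (cbox 0 1 \<times> (cbox 0 1 \<times> cbox 0 1) :: (real \<times> real \<times> real) set)"
    by (intro bounded_Times bounded_cbox)
  ultimately show ?thesis
    by (metis bounded_subset compact_eq_bounded_closed)
qed

lemma borel_unit_triangle [measurable]: "unit_triangle \<in> sets borel"
  using compact_unit_triangle by (rule borel_compact)

section \<open>Symmetries of the unit triangle and independence of the vertex order\<close>

lemma lborel_distr_swap: "distr lborel borel (\<lambda>p. (snd p, fst p)) = (lborel :: (real \<times> real) measure)"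
proof -
  have "lborel \<Otimes>\<^sub>M lborel = distr (lborel \<Otimes>\<^sub>M lborel) (lborel \<Otimes>\<^sub>M lborel) (\<lambda>(x :: real, y :: real). (y, x))"
    by (rule lborel_pair.distr_pair_swap)
  then show ?thesis
    unfolding lborel_prod by (simp add: case_prod_beta' cong: distr_cong)
qed

text \<open>The affine map that exchanges the corners \<open>(0, 0)\<close> and
  \<open>(1, 0)\<close> of the unit triangle and fixes \<open>(0, 1)\<close>. For fixed second
  coordinate it is a reflection of the line followed by a translation, so Fubini shows that it
  preserves the measure.\<close>

lemma lborel_distr_reflect:
  "distr lborel borel (\<lambda>p. (1 - fst p - snd p, snd p)) = (lborel :: (real \<times> real) measure)" (is "?M = _")
proof (rule measure_eqI)
  fix A :: "(real \<times> real) set" assume "A \<in> sets ?M"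
  then have A [measurable]: "A \<in> sets borel" by simp
  have A': "(\<lambda>p. indicator A p :: ennreal) \<in> borel_measurable (lborel \<Otimes>\<^sub>M lborel)"
    unfolding lborel_prod by measurable
  have m: "(\<lambda>p. (1 - fst p - snd p, snd p)) \<in> borel_measurable (borel :: (real \<times> real) measure)"
    by (intro borel_measurable_continuous_onI continuous_intros)
  have A'': "(\<lambda>p. indicator A (1 - fst p - snd p, snd p) :: ennreal) \<in> borel_measurable (lborel \<Otimes>\<^sub>M lborel)"
    unfolding lborel_prod using measurable_compose[OF m borel_measurable_indicator[OF A]] by simp
  have "emeasure ?M A = (\<integral>\<^sup>+p. indicator A p \<partial>?M)" by simp
  also have "\<dots> = (\<integral>\<^sup>+p. indicator A (1 - fst p - snd p, snd p) \<partial>(lborel :: (real \<times> real) measure))"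
    by (rule nn_integral_distr) (use m A in \<open>auto\<close>)
  also have "\<dots> = (\<integral>\<^sup>+t. \<integral>\<^sup>+s. indicator A (1 - s - t, t) \<partial>lborel \<partial>lborel)"
    using lborel_pair.nn_integral_snd[OF A''] by (simp add: lborel_prod)
  also have "\<dots> = (\<integral>\<^sup>+t. \<integral>\<^sup>+s. indicator A (s, t) \<partial>lborel \<partial>lborel)"
  proof (rule nn_integral_cong)
    fix t :: real
    have "(\<lambda>s. indicator A (s, t) :: ennreal) \<in> borel_measurable borel" by measurable
    from nn_integral_real_affine[OF this, of "-1" "1 - t"]
    show "(\<integral>\<^sup>+s. indicator A (1 - s - t, t) \<partial>lborel) = (\<integral>\<^sup>+s. indicator A (s, t) \<partial>lborel)"
      by (simp add: algebra_simps)
  qed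
  also have "\<dots> = emeasure lborel A"
    using lborel_pair.nn_integral_snd[OF A'] by (simp add: lborel_prod)
  finally show "emeasure ?M A = emeasure lborel A" .
qed simp

text \<open>For a nondegenerate triangle this is half the mean value of \<open>g\<close>. The area
  factor is kept apart, because it is absorbed into the volume when the normals are taken into
  account.\<close>

definition triangle_integral :: "point \<Rightarrow> point \<Rightarrow> point \<Rightarrow> (point \<Rightarrow> real) \<Rightarrow> real" where
  "triangle_integral a b c g =
     (LINT p:unit_triangle|lborel. g (a + fst p *\<^sub>R (b - a) + snd p *\<^sub>R (c - a)))"

lemma continuous_on_triangle_param:
  fixes a u w :: point
  assumes "continuous_on UNIV g"
  shows "continuous_on UNIV (\<lambda>p :: real \<times> real. g (a + fst p *\<^sub>R u + snd p *\<^sub>R w))"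
  by (rule continuous_on_compose2[OF assms]) (auto intro!: continuous_intros)

lemma triangle_integral_swap:
  assumes g: "continuous_on UNIV g"
  shows "triangle_integral a c b g = triangle_integral a b c g"
proof -
  have m: "(\<lambda>p. (snd p, fst p)) \<in> borel_measurable (borel :: (real \<times> real) measure)"
    by (intro borel_measurable_continuous_onI continuous_intros)
  have [measurable]: "(\<lambda>p :: real \<times> real. g (a + fst p *\<^sub>R (b - a) + snd p *\<^sub>R (c - a))) \<in> borel_measurable borel"
    by (intro borel_measurable_continuous_onI continuous_on_triangle_param g)
  have m': "(\<lambda>p. indicator unit_triangle p * g (a + fst p *\<^sub>R (b - a) + snd p *\<^sub>R (c - a)))
      \<in> borel_measurable borel"
    by measurable
  have "triangle_integral a b c g = (\<integral>p. indicator unit_triangle p *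
      g (a + fst p *\<^sub>R (b - a) + snd p *\<^sub>R (c - a)) \<partial>distr lborel borel (\<lambda>p. (snd p, fst p)))"
    unfolding triangle_integral_def set_lebesgue_integral_def lborel_distr_swap by simp
  also have "\<dots> = (\<integral>p. indicator unit_triangle p *
      g (a + fst p *\<^sub>R (c - a) + snd p *\<^sub>R (b - a)) \<partial>lborel)"
    using m m' by (subst integral_distr)
      (auto intro!: Bochner_Integration.integral_cong simp: unit_triangle_def indicator_def algebra_simps)
  finally show ?thesis by (simp add: triangle_integral_def set_lebesgue_integral_def)
qed

text \<open>Exchanges the first two vertices; together with the exchange of the last two this
  reaches all six orderings.\<close>

lemma triangle_integral_reflect:
  assumes g: "continuous_on UNIV g"
  shows "triangle_integral b a c g = triangle_integral a b c g"
proof -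
  have m: "(\<lambda>p. (1 - fst p - snd p, snd p)) \<in> borel_measurable (borel :: (real \<times> real) measure)"
    by (intro borel_measurable_continuous_onI continuous_intros)
  have [measurable]: "(\<lambda>p :: real \<times> real. g (a + fst p *\<^sub>R (b - a) + snd p *\<^sub>R (c - a))) \<in> borel_measurable borel"
    by (intro borel_measurable_continuous_onI continuous_on_triangle_param g)
  have m': "(\<lambda>p. indicator unit_triangle p * g (a + fst p *\<^sub>R (b - a) + snd p *\<^sub>R (c - a)))
      \<in> borel_measurable borel"
    by measurable
  have "triangle_integral a b c g = (\<integral>p. indicator unit_triangle p *
      g (a + fst p *\<^sub>R (b - a) + snd p *\<^sub>R (c - a)) \<partial>distr lborel borel (\<lambda>p. (1 - fst p - snd p, snd p)))"
    unfolding triangle_integral_def set_lebesgue_integral_def lborel_distr_reflect by simp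
  also have "\<dots> = (\<integral>p. indicator unit_triangle p *
      g (b + fst p *\<^sub>R (a - b) + snd p *\<^sub>R (c - b)) \<partial>lborel)"
    using m m' by (subst integral_distr)
      (auto intro!: Bochner_Integration.integral_cong simp: unit_triangle_def indicator_def algebra_simps)
  finally show ?thesis by (simp add: triangle_integral_def set_lebesgue_integral_def)
qed

text \<open>The vertices chosen in \<open>face_integral\<close> are a reordering of
  \<open>a, b, c\<close>, and \<open>K\<close> is invariant under the two transpositions that
  generate all reorderings.\<close>

lemma face_integral_triangle:
  assumes g: "continuous_on UNIV g"
    and ind: "\<not> affine_dependent {a, b, c}" "card {a, b, c} = 3"
  shows "face_integral (convex hull {a, b, c}) g =
    norm (cross3 (b - a) (c - a)) * triangle_integral a b c g"
proof -
  define K where "K = (\<lambda>a b c. norm (cross3 (b - a) (c - a)) * triangle_integral a b c g)"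
  have K1: "K a c b = K a b c" for a b c
    unfolding K_def triangle_integral_swap[OF g, of a c b]
    by (subst cross_skew) simp
  have K2: "K b a c = K a b c" for a b c
  proof -
    have "cross3 (a - b) (c - b) = - cross3 (b - a) (c - a)" by (simp add: cross3_simps)
    then show ?thesis unfolding K_def triangle_integral_reflect[OF g, of b a c] by simp
  qed
  let ?P = "\<lambda>(a', b', c'). convex hull {a, b, c} = convex hull {a', b', c' :: point}"
  obtain a' b' c' where S: "(SOME p. ?P p) = (a', b', c')" by (metis prod.collapse)
  have "?P (SOME p. ?P p)" by (rule someI[of ?P "(a, b, c)"]) simp
  then have eq: "convex hull {a, b, c} = convex hull {a', b', c'}" using S by simp
  \<comment> \<open>Extreme points of a hull belong to any set generating it. Since
    \<open>a, b, c\<close> are three distinct points, they exhaust the chosen triple.\<close>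
  have sub: "{a, b, c} \<subseteq> {a', b', c'}"
    using extreme_point_of_convex_hull_affine_independent[OF ind(1)] eq extreme_point_of_convex_hull
    by (metis subsetI)
  have "a \<in> {a', b', c'}" "b \<in> {a', b', c'}" "c \<in> {a', b', c'}" using sub by auto
  moreover have "a \<noteq> b" "b \<noteq> c" "a \<noteq> c" using ind(2) by (auto simp: card_insert_if split: if_splits)
  ultimately have "K a' b' c' = K a b c" by (auto simp: K1 K2)
  then show ?thesis
    unfolding face_integral_def K_def S triangle_integral_def unit_triangle_def by simp
qed

section \<open>Change of variables from the unit tetrahedron\<close>

lemma Basis_prod_vec3:
  fixes u :: "real^3"
  shows "(\<Prod>b\<in>Basis. u \<bullet> b) = u $ 1 * u $ 2 * u $ 3"
proof -
  have B: "(Basis :: (real^3) set) = range (\<lambda>i. axis i 1)" by (auto simp: Basis_vec_def)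
  have "inj (\<lambda>i. axis i 1 :: real^3)" by (rule injI) (simp add: axis_eq_axis)
  then have "(\<Prod>b\<in>Basis. u \<bullet> b) = (\<Prod>i\<in>UNIV. u \<bullet> axis i 1)"
    unfolding B by (simp add: prod.reindex)
  also have "\<dots> = (\<Prod>i\<in>UNIV. u $ i)" by (simp add: inner_axis)
  also have "\<dots> = u $ 1 * u $ 2 * u $ 3" unfolding UNIV_3 by (simp add: ac_simps)
  finally show ?thesis .
qed

lemma continuous_on_vector3:
  "continuous_on UNIV (\<lambda>(r, s, t). vector [r, s, t] :: real^3)" (is "continuous_on _ ?f")
proof -
  have "?f = (\<lambda>p. fst p *\<^sub>R axis 1 1 + fst (snd p) *\<^sub>R axis 2 1 + snd (snd p) *\<^sub>R axis 3 1)"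
    by (auto simp: fun_eq_iff vec_eq_iff forall_3 axis_def)
  then show ?thesis by (simp only:) (intro continuous_intros)
qed

text \<open>Nested pairs carry the product measure needed for Fubini, \<open>real^3\<close> the one
  needed for determinants. The two are identified by their values on boxes.\<close>

lemma lborel_distr_vector3:
  "distr lborel borel (\<lambda>(r, s, t). vector [r, s, t]) = (lborel :: (real^3) measure)" (is "distr _ _ ?f = _")
proof (rule lborel_eqI[symmetric])
  have [measurable]: "?f \<in> borel_measurable borel"
    by (rule borel_measurable_continuous_onI) (rule continuous_on_vector3)
  fix l u :: "real^3" assume le: "\<And>b. b \<in> Basis \<Longrightarrow> l \<bullet> b \<le> u \<bullet> b"
  have le': "l $ i \<le> u $ i" for i using le[of "axis i 1"] by (simp add: inner_axis)
  have "?f -` box l u = box (l $ 1, l $ 2, l $ 3) (u $ 1, u $ 2, u $ 3)"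
    by (auto simp: mem_box_cart forall_3 vector_3 box_prod)
  then have "emeasure (distr lborel borel ?f) (box l u)
      = emeasure lborel (box (l $ 1, l $ 2, l $ 3) (u $ 1, u $ 2, u $ 3))"
    by (subst emeasure_distr) simp_all
  also have "\<dots> = (u $ 1 - l $ 1) * (u $ 2 - l $ 2) * (u $ 3 - l $ 3)"
    using le'
    by (subst emeasure_lborel_box) (auto simp: Basis_prod_def mult.assoc)
  finally show "emeasure (distr lborel borel ?f) (box l u) = (\<Prod>b\<in>Basis. (u - l) \<bullet> b)"
    by (simp add: Basis_prod_vec3)
qed simp

definition tetra_linear :: "point \<Rightarrow> point \<Rightarrow> point \<Rightarrow> point \<Rightarrow> point" where
  "tetra_linear u v w x = x $ 1 *\<^sub>R u + x $ 2 *\<^sub>R v + x $ 3 *\<^sub>R w"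

lemma linear_tetra_linear: "linear (tetra_linear u v w)"
  by (rule linearI) (simp_all add: tetra_linear_def algebra_simps)

lemma det_tetra_linear: "det (matrix (tetra_linear u v w)) = u \<bullet> cross3 v w"
  unfolding dot_cross_det
  by (simp add: det_3 matrix_def tetra_linear_def axis_def vector_3 algebra_simps)

lemma inj_tetra_linear:
  assumes "tetra a b c d"
  shows "inj (tetra_linear (b - a) (c - a) (d - a))"
proof (rule linear_surjective_imp_injective[OF linear_tetra_linear])
  show "surj (tetra_linear (b - a) (c - a) (d - a))"
    unfolding surj_def
  proof
    fix y
    have "y \<in> span {b - a, c - a, d - a}" using tetra_edges_span[OF assms] by simp
    then obtain k l m where "y - k *\<^sub>R (b - a) - l *\<^sub>R (c - a) - m *\<^sub>R (d - a) = 0"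
      by (auto simp: span_breakdown_eq)
    then have "y = tetra_linear (b - a) (c - a) (d - a) (vector [k, l, m])"
      by (simp add: tetra_linear_def algebra_simps)
    then show "\<exists>x. y = tetra_linear (b - a) (c - a) (d - a) x" by blast
  qed
qed simp

text \<open>Change of variables as an equality of measures, so that an integral can be transformed
  by rewriting its measure. On a box, the preimage under \<open>f\<close> is the image under the
  inverse \<open>g\<close>, and the factor \<open>\<bar>det (matrix f)\<bar>\<close> undoes the
  scaling by \<open>g\<close>.\<close>

lemma lborel_distr_linear:
  fixes f :: "real^'n::{finite,wellorder} \<Rightarrow> real^'n::_"
  assumes f: "linear f" "inj f"
  shows "lborel = density (distr lborel borel f) (\<lambda>_. ennreal \<bar>det (matrix f)\<bar>)" (is "_ = ?M")
proof (rule lborel_eqI)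
  have m [measurable]: "f \<in> borel_measurable borel"
    by (intro borel_measurable_continuous_onI linear_continuous_on linear_conv_bounded_linear[THEN iffD1] f)
  obtain g where g: "linear g" "g \<circ> f = id" "f \<circ> g = id"
    using linear_injective_isomorphism[OF f] by (auto simp: fun_eq_iff)
  fix l u :: "real^'n::_" assume le: "\<And>b. b \<in> Basis \<Longrightarrow> l \<bullet> b \<le> u \<bullet> b"
  have vim: "f -` box l u = g ` box l u"
    using g(2,3) by (auto simp: fun_eq_iff image_iff) metis
  have img: "f ` g ` box l u = box l u"
    using g(3) by (auto simp: fun_eq_iff image_iff)
  have gm: "g ` box l u \<in> lmeasurable"
    by (intro measurable_linear_image g) auto
  have "emeasure lborel (f -` box l u) = emeasure lebesgue (g ` box l u)"
    using measurable_sets[OF m, of "box l u"] unfolding vim[symmetric] by (simp add: emeasure_completion)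
  also have "\<dots> = ennreal (measure lebesgue (g ` box l u))"
    using gm by (simp add: emeasure_eq_measure2)
  finally have e: "emeasure lborel (f -` box l u) = ennreal (measure lebesgue (g ` box l u))" .
  have "emeasure ?M (box l u) = ennreal \<bar>det (matrix f)\<bar> * emeasure lborel (f -` box l u)"
    by (simp add: emeasure_density nn_integral_cmult emeasure_distr)
  also have "\<dots> = ennreal (\<bar>det (matrix f)\<bar> * measure lebesgue (g ` box l u))"
    unfolding e by (simp add: ennreal_mult)
  also have "\<bar>det (matrix f)\<bar> * measure lebesgue (g ` box l u) = measure lebesgue (box l u)"
    using measure_linear_image[OF f(1) gm] img by simp
  also have "ennreal \<dots> = (\<Prod>b\<in>Basis. (u - l) \<bullet> b)"
    using le by (subst emeasure_eq_measure2[symmetric]) (auto simp: emeasure_lborel_box)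
  finally show "emeasure ?M (box l u) = (\<Prod>b\<in>Basis. (u - l) \<bullet> b)" .
qed simp

definition tetra_map :: "point \<Rightarrow> point \<Rightarrow> point \<Rightarrow> point \<Rightarrow> real \<times> real \<times> real \<Rightarrow> point" where
  "tetra_map a b c d = (\<lambda>(r, s, t). a + r *\<^sub>R (b - a) + s *\<^sub>R (c - a) + t *\<^sub>R (d - a))"

lemma continuous_on_tetra_map: "continuous_on A (tetra_map a b c d)"
  unfolding tetra_map_def case_prod_beta' by (intro continuous_intros)

lemma inj_tetra_map:
  assumes "tetra a b c d"
  shows "inj (tetra_map a b c d)"
proof (rule injI)
  fix p q assume eq: "tetra_map a b c d p = tetra_map a b c d q"
  obtain r s t r' s' t' where pq: "p = (r, s, t)" "q = (r', s', t')" by (metis prod.collapse)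
  let ?g = "tetra_linear (b - a) (c - a) (d - a)"
  have "?g (vector [r, s, t]) = ?g (vector [r', s', t'])"
    using eq unfolding pq tetra_map_def tetra_linear_def by (simp add: algebra_simps)
  then have "vector [r, s, t] = (vector [r', s', t'] :: point)"
    using inj_tetra_linear[OF assms] by (simp add: inj_eq)
  then show "p = q" unfolding pq by (metis vector_3)
qed

text \<open>One inclusion writes a point other than \<open>a\<close> as a convex combination of
  \<open>a\<close> and a point of the opposite face; for the other, the affine image of a convex set
  is convex and contains the four vertices.\<close>

lemma tetra_map_unit_tetrahedron:
  "tetra_map a b c d ` unit_tetrahedron = convex hull {a, b, c, d}"
proof
  show "tetra_map a b c d ` unit_tetrahedron \<subseteq> convex hull {a, b, c, d}"
  proof clarify
    fix r s t assume "(r, s, t) \<in> unit_tetrahedron"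
    then have *: "0 \<le> r" "0 \<le> s" "0 \<le> t" "r + s + t \<le> 1" by (auto simp: unit_tetrahedron_def)
    show "tetra_map a b c d (r, s, t) \<in> convex hull {a, b, c, d}"
    proof (cases "r + s + t = 0")
      case True
      then have "r = 0" "s = 0" "t = 0" using * by auto
      then show ?thesis by (simp add: tetra_map_def hull_inc)
    next
      case False
      \<comment> \<open>\<open>z\<close> is where the ray from \<open>a\<close> through the point
        meets the opposite face, and \<open>k\<close> is the fraction of the way to it.\<close>
      define k where "k = r + s + t"
      define z where "z = (r / k) *\<^sub>R b + (s / k) *\<^sub>R c + (t / k) *\<^sub>R d"
      have k: "k > 0" "k \<le> 1" using * False by (auto simp: k_def)
      have "r / k + s / k + t / k = 1" 
        using k by (simp add: add_divide_distrib[symmetric] k_def[symmetric])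
      then have "z \<in> convex hull {b, c, d}"
        using * k unfolding convex_hull_3 z_def
        by (intro CollectI exI[of _ "r / k"] exI[of _ "s / k"] exI[of _ "t / k"]) auto
      then have z: "z \<in> convex hull {a, b, c, d}"
        by (rule subsetD[OF hull_mono, rotated]) auto
      have kz: "k *\<^sub>R z = r *\<^sub>R b + s *\<^sub>R c + t *\<^sub>R d"
        using k by (simp add: z_def algebra_simps)
      have "tetra_map a b c d (r, s, t) = (1 - k) *\<^sub>R a + k *\<^sub>R z"
        unfolding kz by (simp add: tetra_map_def k_def algebra_simps)
      also have "\<dots> \<in> convex hull {a, b, c, d}"
        using k z by (intro convexD[OF convex_convex_hull]) (auto simp: hull_inc)
      finally show ?thesis .
    qed
  qed
  have "convex (tetra_map a b c d ` unit_tetrahedron)"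
  proof -
    have "linear (\<lambda>(r, s, t). r *\<^sub>R (b - a) + s *\<^sub>R (c - a) + t *\<^sub>R (d - a))"
      by (rule linearI) (auto simp: algebra_simps)
    moreover have "convex unit_tetrahedron"
    proof (rule convexI)
      fix x y :: "real \<times> real \<times> real" and u v :: real
      assume "x \<in> unit_tetrahedron" "y \<in> unit_tetrahedron" and uv: "0 \<le> u" "0 \<le> v" "u + v = 1"
      then obtain r s t r' s' t' where xy: "x = (r, s, t)" "y = (r', s', t')"
        and *: "0 \<le> r" "0 \<le> s" "0 \<le> t" "r + s + t \<le> 1" "0 \<le> r'" "0 \<le> s'" "0 \<le> t'" "r' + s' + t' \<le> 1"
        by (auto simp: unit_tetrahedron_def)
      have "u * (r + s + t) + v * (r' + s' + t') \<le> u * 1 + v * 1"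
        using * uv by (intro add_mono mult_left_mono)
      then show "u *\<^sub>R x + v *\<^sub>R y \<in> unit_tetrahedron"
        using * uv by (auto simp: xy unit_tetrahedron_def algebra_simps)
    qed
    ultimately have "convex ((+) a ` (\<lambda>(r, s, t). r *\<^sub>R (b - a) + s *\<^sub>R (c - a) + t *\<^sub>R (d - a)) ` unit_tetrahedron)"
      by (intro convex_translation convex_linear_image)
    moreover have "(+) a ` (\<lambda>(r, s, t). r *\<^sub>R (b - a) + s *\<^sub>R (c - a) + t *\<^sub>R (d - a)) ` unit_tetrahedron
      = tetra_map a b c d ` unit_tetrahedron"
      unfolding image_image by (rule image_cong) (auto simp: tetra_map_def algebra_simps)
    ultimately show ?thesis by simp
  qed
  moreover have "{a, b, c, d} \<subseteq> tetra_map a b c d ` unit_tetrahedron"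
  proof -
    have "a = tetra_map a b c d (0, 0, 0)" "b = tetra_map a b c d (1, 0, 0)"
      "c = tetra_map a b c d (0, 1, 0)" "d = tetra_map a b c d (0, 0, 1)"
      by (simp_all add: tetra_map_def)
    moreover have "(0, 0, 0) \<in> unit_tetrahedron" "(1, 0, 0) \<in> unit_tetrahedron"
      "(0, 1, 0) \<in> unit_tetrahedron" "(0, 0, 1) \<in> unit_tetrahedron"
      by (simp_all add: unit_tetrahedron_def)
    ultimately show ?thesis by (metis (no_types, lifting) empty_subsetI imageI insert_subset)
  qed
  ultimately show "convex hull {a, b, c, d} \<subseteq> tetra_map a b c d ` unit_tetrahedron"
    by (rule hull_minimal[rotated])
qed

lemma tetra_integral:
  fixes f :: "point \<Rightarrow> real"
  assumes t: "tetra a b c d" and f: "continuous_on UNIV f"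
  shows "(LINT x:convex hull {a, b, c, d}|lebesgue. f x) =
    \<bar>(b - a) \<bullet> cross3 (c - a) (d - a)\<bar> * (LINT p:unit_tetrahedron|lborel. f (tetra_map a b c d p))"
proof -
  let ?D = "convex hull {a, b, c, d}" and ?g = "tetra_linear (b - a) (c - a) (d - a)"
  let ?V = "\<lambda>(r, s, t). vector [r, s, t] :: point"
  define h where "h = (\<lambda>x. indicator ?D x * f x)"
  have "compact ?D" by (intro finite_imp_compact_convex_hull) auto
  then have [measurable]: "?D \<in> sets borel" by (rule borel_compact)
  have [measurable]: "f \<in> borel_measurable borel" using f by (rule borel_measurable_continuous_onI)
  have h [measurable]: "h \<in> borel_measurable borel" unfolding h_def by measurable
  have gm [measurable]: "?g \<in> borel_measurable borel"
    by (intro borel_measurable_continuous_onI linear_continuous_on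
        linear_conv_bounded_linear[THEN iffD1] linear_tetra_linear)
  have Vm [measurable]: "?V \<in> borel_measurable borel"
    by (rule borel_measurable_continuous_onI) (rule continuous_on_vector3)
  have "(LINT x:?D|lebesgue. f x) = integral\<^sup>L lborel h"
    unfolding set_lebesgue_integral_def h_def using h
    by (subst integral_completion) (auto simp: h_def)
  also have "\<dots> = integral\<^sup>L lborel (\<lambda>x. h (a + x))"
    by (subst lborel_distr_plus[of a, symmetric], subst integral_distr) auto
  also have "\<dots> = integral\<^sup>L (density (distr lborel borel ?g) (\<lambda>_. ennreal \<bar>det (matrix ?g)\<bar>)) (\<lambda>x. h (a + x))"
    by (subst lborel_distr_linear[OF linear_tetra_linear inj_tetra_linear[OF t]]) simp
  also have "\<dots> = \<bar>(b - a) \<bullet> cross3 (c - a) (d - a)\<bar> * integral\<^sup>L lborel (\<lambda>x. h (a + ?g x))"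
    by (simp add: integral_density integral_distr det_tetra_linear)
  also have "integral\<^sup>L lborel (\<lambda>x. h (a + ?g x)) = integral\<^sup>L lborel (\<lambda>p. h (a + ?g (?V p)))"
    by (subst lborel_distr_vector3[symmetric], subst integral_distr) auto
  also have "\<dots> = (LINT p:unit_tetrahedron|lborel. f (tetra_map a b c d p))"
    unfolding set_lebesgue_integral_def
  proof (rule Bochner_Integration.integral_cong)
    fix p :: "real \<times> real \<times> real"
    have 1: "a + ?g (?V p) = tetra_map a b c d p"
      by (simp add: tetra_linear_def tetra_map_def split_beta add_ac)
    \<comment> \<open>Injectivity makes the indicator of the element pull back exactly to that of
      the unit tetrahedron.\<close>
    have "tetra_map a b c d p \<in> ?D \<longleftrightarrow> p \<in> unit_tetrahedron"
      unfolding tetra_map_unit_tetrahedron[symmetric] using inj_tetra_map[OF t] by (simp add: inj_image_mem_iff)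
    then show "h (a + ?g (?V p)) = indicator unit_tetrahedron p *\<^sub>R f (tetra_map a b c d p)"
      unfolding h_def 1 by (simp add: indicator_def)
  qed simp
  finally show ?thesis .
qed

text \<open>With \<open>(s, t)\<close> fixed, \<open>r\<close> runs over
  \<open>{0..1 - s - t}\<close> and the point moves parallel to \<open>b - a\<close>, from the face
  \<open>a, c, d\<close> to the face \<open>b, c, d\<close>. Both faces are thus parametrized by the
  same unit triangle, so the boundary values integrate to \<open>triangle_integral\<close> without
  further factors.\<close>

lemma integral_directional_derivative_unit_tetrahedron:
  fixes p :: "point \<Rightarrow> real" and p' :: "point \<Rightarrow> point \<Rightarrow> real"
  assumes der: "\<And>x. (p has_derivative p' x) (at x)"
    and cont: "continuous_on UNIV (\<lambda>x. p' x (b - a))"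
  shows "(LINT q:unit_tetrahedron|lborel. p' (tetra_map a b c d q) (b - a)) =
    triangle_integral b c d p - triangle_integral a c d p"
proof -
  define f where "f = (\<lambda>q. p' (tetra_map a b c d q) (b - a))"
  have pc: "continuous_on UNIV p"
    using der by (meson continuous_at_imp_continuous_on has_derivative_continuous)
  have fc: "continuous_on UNIV f"
    unfolding f_def by (rule continuous_on_compose2[OF cont continuous_on_tetra_map]) auto
  define F where "F = (\<lambda>r st. indicator unit_tetrahedron (r, st) * f (r, st))"
  have "integrable lborel (\<lambda>q. indicator unit_tetrahedron q *\<^sub>R f q)"
    by (intro borel_integrable_compact compact_unit_tetrahedron continuous_on_subset[OF fc]) auto
  then have int: "integrable (lborel \<Otimes>\<^sub>M lborel) (case_prod F)"
    by (simp add: F_def lborel_prod case_prod_beta')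
  have inner: "(\<integral>r. F r st \<partial>lborel) =
      indicator unit_triangle st *
        (p (b + fst st *\<^sub>R (c - b) + snd st *\<^sub>R (d - b)) - p (a + fst st *\<^sub>R (c - a) + snd st *\<^sub>R (d - a)))" for st
  proof -
    obtain s t where st: "st = (s, t)" by fastforce
    show ?thesis
    proof (cases "st \<in> unit_triangle")
      case True
      then have *: "0 \<le> s" "0 \<le> t" "s + t \<le> 1" by (auto simp: st unit_triangle_def)
      let ?x = "\<lambda>r. tetra_map a b c d (r, s, t)"
      have "(\<integral>r. indicator {0..1 - s - t} r *\<^sub>R f (r, s, t) \<partial>lborel) = p (?x (1 - s - t)) - p (?x 0)"
      proof (rule integral_FTC_Icc)
        show "0 \<le> 1 - s - t" using * by simp
        show "continuous_on {0..1 - s - t} (\<lambda>r. f (r, s, t))"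
          by (rule continuous_on_compose2[OF fc]) (auto intro!: continuous_intros)
        fix r
        have "(?x has_derivative (\<lambda>h. h *\<^sub>R (b - a))) (at r within {0..1 - s - t})"
          unfolding tetra_map_def by (auto intro!: derivative_eq_intros)
        from has_derivative_compose[OF this der]
        have "((\<lambda>r. p (?x r)) has_derivative (\<lambda>h. p' (?x r) (h *\<^sub>R (b - a)))) (at r within {0..1 - s - t})" .
        moreover have "p' (?x r) (h *\<^sub>R (b - a)) = h *\<^sub>R p' (?x r) (b - a)" for h
          using der has_derivative_linear linear_scale by blast
        ultimately show "((\<lambda>r. p (?x r)) has_vector_derivative f (r, s, t)) (at r within {0..1 - s - t})"
          by (simp add: has_vector_derivative_def f_def)
      qed
      moreover have "F r st = indicator {0..1 - s - t} r *\<^sub>R f (r, s, t)" for r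
        using * by (auto simp: F_def st unit_tetrahedron_def indicator_def)
      moreover have "?x (1 - s - t) = b + s *\<^sub>R (c - b) + t *\<^sub>R (d - b)"
        by (simp add: tetra_map_def algebra_simps)
      moreover have "?x 0 = a + s *\<^sub>R (c - a) + t *\<^sub>R (d - a)"
        by (simp add: tetra_map_def)
      ultimately show ?thesis using True by (simp add: st)
    next
      case False
      then have "F r st = 0" for r
        by (auto simp: F_def st unit_triangle_def unit_tetrahedron_def indicator_def)
      with False show ?thesis by simp
    qed
  qed
  have tint: "set_integrable lborel unit_triangle (\<lambda>q. p (x + fst q *\<^sub>R u + snd q *\<^sub>R w))" for x u w
    unfolding set_integrable_def
    by (intro borel_integrable_compact compact_unit_triangle
        continuous_on_subset[OF continuous_on_triangle_param[OF pc]]) auto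
  have "(LINT q:unit_tetrahedron|lborel. p' (tetra_map a b c d q) (b - a)) =
      integral\<^sup>L (lborel \<Otimes>\<^sub>M lborel) (case_prod F)"
    unfolding set_lebesgue_integral_def f_def[symmetric]
    by (simp add: F_def lborel_prod case_prod_beta')
  also have "\<dots> = (\<integral>st. \<integral>r. F r st \<partial>lborel \<partial>lborel)"
    using lborel_pair.integral_snd[OF int] by simp
  also have "\<dots> = triangle_integral b c d p - triangle_integral a c d p"
    unfolding inner triangle_integral_def set_integral_diff(2)[OF tint tint, symmetric]
    by (simp add: set_lebesgue_integral_def)
  finally show ?thesis .
qed

section \<open>The divergence theorem on a tetrahedron\<close>

lemma set_integrable_continuous:
  fixes f :: "'a::euclidean_space \<Rightarrow> real"
  assumes "compact D" "continuous_on UNIV f"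
  shows "set_integrable lebesgue D f"
proof -
  have int: "integrable lborel (\<lambda>x. indicator D x *\<^sub>R f x)"
    by (rule borel_integrable_compact[OF assms(1) continuous_on_subset[OF assms(2) subset_UNIV]])
  show ?thesis unfolding set_integrable_def 
    using integrable_completion[of "\<lambda>x. indicator D x *\<^sub>R f x" lborel] int borel_measurable_integrable[OF int]
    by simp
qed

text \<open>Some triple is chosen for every set \<open>F\<close>, triangle or not, so linearity and
  positivity can be read off this form for arbitrary \<open>F\<close>.\<close>

lemma face_integral_alt:
  obtains k a u w where "k \<ge> 0"
    "\<And>g. face_integral F g = k * (LINT p:unit_triangle|lborel. g (a + fst p *\<^sub>R u + snd p *\<^sub>R w))"
proof -
  obtain a b c where S: "(SOME (a, b, c). F = convex hull {a, b, c}) = (a, b, c)" by (metis prod.collapse)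
  show thesis
    by (rule that[of "norm (cross3 (b - a) (c - a))" a "b - a" "c - a"])
      (simp_all add: face_integral_def S unit_triangle_def)
qed

lemma set_integrable_triangle_param:
  assumes "continuous_on UNIV g"
  shows "set_integrable lborel unit_triangle (\<lambda>p. g (a + fst p *\<^sub>R u + snd p *\<^sub>R w :: point) :: real)"
  unfolding set_integrable_def
  by (intro borel_integrable_compact compact_unit_triangle
      continuous_on_subset[OF continuous_on_triangle_param[OF assms]]) auto

lemma face_integral_add:
  assumes "continuous_on UNIV f" "continuous_on UNIV g"
  shows "face_integral F (\<lambda>x. f x + g x) = face_integral F f + face_integral F g"
proof -
  obtain k a u w where k:
    "\<And>g. face_integral F g = k * (LINT p:unit_triangle|lborel. g (a + fst p *\<^sub>R u + snd p *\<^sub>R w))"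
    by (rule face_integral_alt[of F]) blast
  show ?thesis
    unfolding k using set_integrable_triangle_param[OF assms(1)] set_integrable_triangle_param[OF assms(2)]
    by (simp add: set_integral_add(2) distrib_left)
qed

lemma face_integral_cmult: "face_integral F (\<lambda>x. c * f x) = c * face_integral F f"
proof -
  obtain k a u w where k:
    "\<And>g. face_integral F g = k * (LINT p:unit_triangle|lborel. g (a + fst p *\<^sub>R u + snd p *\<^sub>R w))"
    by (rule face_integral_alt[of F]) blast
  show ?thesis unfolding k by simp
qed

lemma face_integral_minus: "face_integral F (\<lambda>x. - f x) = - face_integral F f"
  using face_integral_cmult[of F "-1" f] by simp

lemma face_integral_zero [simp]: "face_integral F (\<lambda>x. 0) = 0"
  using face_integral_cmult[of F 0 "\<lambda>x. 0"] by simp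

lemma face_integral_nonneg:
  assumes "\<And>x. 0 \<le> f x"
  shows "0 \<le> face_integral F f"
proof -
  obtain k a u w where k: "k \<ge> 0"
    "\<And>g. face_integral F g = k * (LINT p:unit_triangle|lborel. g (a + fst p *\<^sub>R u + snd p *\<^sub>R w))"
    by (rule face_integral_alt[of F]) blast
  show ?thesis
    unfolding k(2) set_lebesgue_integral_def using k(1) assms
    by (intro mult_nonneg_nonneg Bochner_Integration.integral_nonneg) auto
qed

lemma face_integral_sum:
  assumes "finite I" "\<And>i. i \<in> I \<Longrightarrow> continuous_on UNIV (f i)"
  shows "face_integral F (\<lambda>x. \<Sum>i\<in>I. f i x) = (\<Sum>i\<in>I. face_integral F (f i))"
  using assms
proof (induction I rule: finite_induct)
  case (insert j I)
  then show ?case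
    by (simp add: face_integral_add continuous_on_sum)
qed simp

text \<open>The faces opposite to \<open>c\<close> and \<open>d\<close> contain the edge, so their
  normals are orthogonal to it. For the other two, area times normal component along the edge is
  base times height, hence the same \<open>\<Delta>\<close> up to sign; the normal of the face
  opposite to \<open>b\<close> points against \<open>b - a\<close>.\<close>

lemma divergence_edge:
  fixes p :: "point \<Rightarrow> real"
  assumes t: "tetra a b c d" and D: "D = convex hull {a, b, c, d}"
    and der: "\<And>x. (p has_derivative p' x) (at x)"
    and cont: "continuous_on UNIV (\<lambda>x. p' x (b - a))"
  shows "(LINT x:D|lebesgue. p' x (b - a)) =
    (\<Sum>F | F facet_of D. (outward_normal D F \<bullet> (b - a)) * face_integral F p)"
proof -
  have pc: "continuous_on UNIV p"
    using der by (meson continuous_at_imp_continuous_on has_derivative_continuous)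
  have t': "tetra b a c d" "tetra c a b d" "tetra d a b c" using t tetra_perm by blast+
  have D': "D = convex hull {b, a, c, d}" "D = convex hull {c, a, b, d}" "D = convex hull {d, a, b, c}"
    unfolding D by (simp_all add: insert_commute)
  let ?A = "convex hull {b, c, d}" and ?B = "convex hull {a, c, d}"
    and ?C = "convex hull {a, b, d}" and ?E = "convex hull {a, b, c}"
  have facets: "{F. F facet_of D} = {?A, ?B, ?C, ?E}"
    using facet_of_tetra[OF t] by (auto simp: D)
  have dist: "?A \<noteq> ?B" "?A \<noteq> ?C" "?A \<noteq> ?E" "?B \<noteq> ?C" "?B \<noteq> ?E" "?C \<noteq> ?E"
  proof -
    have *: "convex hull {y, z, w} \<noteq> convex hull {x, z, w}" if "tetra x y z w" for x y z w
      using tetra_facets_distinct that by blast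
    have "tetra a c b d" "tetra a d b c" "tetra b c a d" "tetra b d a c" "tetra c d a b"
      using t tetra_perm by blast+
    from this[THEN *] *[OF t]
    show "?A \<noteq> ?B" "?A \<noteq> ?C" "?A \<noteq> ?E" "?B \<noteq> ?C" "?B \<noteq> ?E" "?C \<noteq> ?E"
      by (simp_all add: insert_commute)
  qed
  have ind: "\<not> affine_dependent {b, c, d}" "card {b, c, d} = 3" if "tetra a b c d" for a b c d
    using that tetra_distinct[OF that] affine_independent_subset[of "{a, b, c, d}" "{b, c, d}"]
    by (auto simp: tetra_def)
  define \<Delta> where "\<Delta> = \<bar>(b - a) \<bullet> cross3 (c - a) (d - a)\<bar>"
  have A: "(outward_normal D ?A \<bullet> (b - a)) * face_integral ?A p = \<Delta> * triangle_integral b c d p"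
    using norm_cross3_mult_outward_normal(1)[OF t] face_integral_triangle[OF pc ind[OF t]]
    unfolding D \<Delta>_def by (simp add: mult_ac)
  have B: "(outward_normal D ?B \<bullet> (b - a)) * face_integral ?B p = - (\<Delta> * triangle_integral a c d p)"
  proof -
    have "\<bar>(a - b) \<bullet> cross3 (c - b) (d - b)\<bar> = \<Delta>"
    proof -
      have "(a - b) \<bullet> cross3 (c - b) (d - b) = - ((b - a) \<bullet> cross3 (c - a) (d - a))"
        by (simp add: cross3_simps)
      then show ?thesis by (simp add: \<Delta>_def)
    qed
    then have *: "norm (cross3 (c - a) (d - a)) * (outward_normal D ?B \<bullet> (a - b)) = \<Delta>"
      using norm_cross3_mult_outward_normal(1)[OF t'(1)] unfolding D'(1) by simp
    have "outward_normal D ?B \<bullet> (b - a) = - (outward_normal D ?B \<bullet> (a - b))"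
      by (simp add: inner_diff_right)
    then show ?thesis
      unfolding face_integral_triangle[OF pc ind[OF t'(1)]] *[symmetric] by (simp add: mult_ac)
  qed
  have C: "outward_normal D ?C \<bullet> (b - a) = 0"
    using norm_cross3_mult_outward_normal(2)[OF t'(2)] unfolding D'(2) .
  have E: "outward_normal D ?E \<bullet> (b - a) = 0"
    using norm_cross3_mult_outward_normal(2)[OF t'(3)] unfolding D'(3) .
  have "(\<Sum>F | F facet_of D. (outward_normal D F \<bullet> (b - a)) * face_integral F p)
      = \<Delta> * triangle_integral b c d p - \<Delta> * triangle_integral a c d p"
    unfolding facets using dist A B C E by simp
  also have "\<dots> = (LINT x:D|lebesgue. p' x (b - a))"
    unfolding D tetra_integral[OF t cont] integral_directional_derivative_unit_tetrahedron[OF der cont] \<Delta>_def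
    by (simp add: right_diff_distrib)
  finally show ?thesis by simp
qed

lemma divergence_direction:
  fixes p :: "point \<Rightarrow> real"
  assumes D: "3 simplex D"
    and der: "\<And>x. (p has_derivative p' x) (at x)"
    and cont: "\<And>w. continuous_on UNIV (\<lambda>x. p' x w)"
  shows "(LINT x:D|lebesgue. p' x w) =
    (\<Sum>F | F facet_of D. (outward_normal D F \<bullet> w) * face_integral F p)"
proof -
  obtain a b c d where t: "tetra a b c d" and Dt: "D = convex hull {a, b, c, d}"
    using three_simplex_tetra[OF D] by blast
  \<comment> \<open>The defect of the divergence theorem in direction \<open>w\<close>. It is linear
    in \<open>w\<close> and vanishes on the spanning edges by
    \<open>divergence_edge\<close>.\<close>
  define R where "R = (\<lambda>w. (LINT x:D|lebesgue. p' x w) -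
    (\<Sum>F | F facet_of D. (outward_normal D F \<bullet> w) * face_integral F p))"
  have lin: "linear (p' x)" for x using der by (rule has_derivative_linear)
  have int: "set_integrable lebesgue D (\<lambda>x. p' x w)" for w
    using three_simplex_props(1)[OF D] cont by (rule set_integrable_continuous)
  have "linear R"
  proof (rule linearI)
    show "R (u + w) = R u + R w" for u w
      unfolding R_def linear_add[OF lin] set_integral_add(2)[OF int int]
      by (simp add: inner_add_right distrib_right sum.distrib)
    show "R (k *\<^sub>R w) = k *\<^sub>R R w" for k w
      unfolding R_def linear_scale[OF lin] by (simp add: right_diff_distrib sum_distrib_left mult.assoc)
  qed
  moreover have "R w = 0" if "w \<in> {b - a, c - a, d - a}" for w
  proof -
    have t': "tetra a c b d" "tetra a d b c" using t tetra_perm by blast+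
    have Dt': "D = convex hull {a, c, b, d}" "D = convex hull {a, d, b, c}"
      unfolding Dt by (simp_all add: insert_commute)
    have "R (b - a) = 0" "R (c - a) = 0" "R (d - a) = 0"
      using divergence_edge[OF t Dt der cont] divergence_edge[OF t'(1) Dt'(1) der cont]
        divergence_edge[OF t'(2) Dt'(2) der cont]
      unfolding R_def by simp_all
    with that show ?thesis by auto
  qed
  moreover have "w \<in> span {b - a, c - a, d - a}" using tetra_edges_span[OF t] by simp
  ultimately have "R w = 0" by (rule linear_eq_0_on_span)
  then show ?thesis by (simp add: R_def)
qed

lemma divergence_simplex:
  fixes G :: "3 \<Rightarrow> point \<Rightarrow> real"
  assumes D: "3 simplex D"
    and der: "\<And>i x. (G i has_derivative G' i x) (at x)"
    and cont: "\<And>i w. continuous_on UNIV (\<lambda>x. G' i x w)"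
  shows "(LINT x:D|lebesgue. \<Sum>i\<in>UNIV. G' i x (axis i 1)) =
    (\<Sum>F | F facet_of D. face_integral F (\<lambda>x. \<Sum>i\<in>UNIV. outward_normal D F $ i * G i x))"
proof -
  have Gc: "continuous_on UNIV (G i)" for i
    using der by (meson continuous_at_imp_continuous_on has_derivative_continuous)
  have int: "set_integrable lebesgue D (\<lambda>x. G' i x w)" for i w
    using three_simplex_props(1)[OF D] cont by (rule set_integrable_continuous)
  have "(LINT x:D|lebesgue. \<Sum>i\<in>UNIV. G' i x (axis i 1)) = (\<Sum>i\<in>UNIV. LINT x:D|lebesgue. G' i x (axis i 1))"
    unfolding set_lebesgue_integral_def scaleR_sum_right
    by (rule Bochner_Integration.integral_sum) (rule int[unfolded set_integrable_def])
  also have "\<dots> = (\<Sum>i\<in>UNIV. \<Sum>F | F facet_of D. outward_normal D F $ i * face_integral F (G i))"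
    unfolding divergence_direction[OF D der cont] by (simp add: inner_axis)
  also have "\<dots> = (\<Sum>F | F facet_of D. \<Sum>i\<in>UNIV. face_integral F (\<lambda>x. outward_normal D F $ i * G i x))"
    unfolding face_integral_cmult by (rule sum.swap)
  also have "\<dots> = (\<Sum>F | F facet_of D. face_integral F (\<lambda>x. \<Sum>i\<in>UNIV. outward_normal D F $ i * G i x))"
    using Gc by (subst face_integral_sum) (auto intro!: continuous_intros)
  finally show ?thesis .
qed

section \<open>Polynomial fields and the derivative of the energy\<close>

text \<open>Continuity is required of each directional derivative, not of the derivative as an
  operator-valued map. In finite dimension this is equivalent, and it is the form that the
  divergence theorem uses.\<close>

definition C1_fun :: "(point \<Rightarrow> 'a::real_normed_vector) \<Rightarrow> bool" where
  "C1_fun f \<longleftrightarrow> (\<exists>f'. (\<forall>x. (f has_derivative f' x) (at x)) \<and> (\<forall>w. continuous_on UNIV (\<lambda>x. f' x w)))"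

lemma C1_fun_frechet_derivative:
  assumes "C1_fun f"
  shows "(f has_derivative frechet_derivative f (at x)) (at x)"
    and "continuous_on UNIV (\<lambda>x. frechet_derivative f (at x) w)"
proof -
  obtain f' where f': "\<And>x. (f has_derivative f' x) (at x)" "\<And>w. continuous_on UNIV (\<lambda>x. f' x w)"
    using assms unfolding C1_fun_def by blast
  then have "frechet_derivative f (at x) = f' x" for x using frechet_derivative_at by metis
  with f' show "(f has_derivative frechet_derivative f (at x)) (at x)"
    "continuous_on UNIV (\<lambda>x. frechet_derivative f (at x) w)" by simp_all
qed

lemma C1_fun_continuous_on: "C1_fun f \<Longrightarrow> continuous_on A f"
  using C1_fun_frechet_derivative(1)
  by (meson continuous_at_imp_continuous_on has_derivative_continuous)

text \<open>One product rule for real products and for scaled vectors; it builds monomials and then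
  vector fields from their components.\<close>

lemma C1_fun_bilinear:
  assumes b: "bounded_bilinear h" and f: "C1_fun f" and g: "C1_fun g"
  shows "C1_fun (\<lambda>x. h (f x) (g x))"
  unfolding C1_fun_def
proof (intro exI conjI allI)
  fix x
  show "((\<lambda>x. h (f x) (g x)) has_derivative
      (\<lambda>w. h (f x) (frechet_derivative g (at x) w) + h (frechet_derivative f (at x) w) (g x))) (at x)"
    using C1_fun_frechet_derivative(1)[OF f] C1_fun_frechet_derivative(1)[OF g]
    by (rule bounded_bilinear.FDERIV[OF b])
next
  fix w
  show "continuous_on UNIV (\<lambda>x. h (f x) (frechet_derivative g (at x) w) + h (frechet_derivative f (at x) w) (g x))"
    by (intro continuous_on_add bounded_bilinear.continuous_on[OF b]
        C1_fun_continuous_on f g C1_fun_frechet_derivative(2))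
qed

lemma C1_fun_const: "C1_fun (\<lambda>x. c)"
  unfolding C1_fun_def by (rule exI[of _ "\<lambda>_ _. 0"]) auto

lemma C1_fun_nth: "C1_fun (\<lambda>x. x $ i)"
  unfolding C1_fun_def
  by (rule exI[of _ "\<lambda>_ w. w $ i"])
    (auto intro!: bounded_linear_imp_has_derivative bounded_linear_vec_nth)

lemma C1_fun_add:
  assumes f: "C1_fun f" and g: "C1_fun g"
  shows "C1_fun (\<lambda>x. f x + g x)"
  unfolding C1_fun_def
  by (rule exI[of _ "\<lambda>x w. frechet_derivative f (at x) w + frechet_derivative g (at x) w"])
    (auto intro!: has_derivative_add continuous_on_add C1_fun_frechet_derivative f g)

lemma C1_fun_sum:
  assumes "\<And>i. i \<in> I \<Longrightarrow> C1_fun (f i)"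
  shows "C1_fun (\<lambda>x. \<Sum>i\<in>I. f i x)"
  using assms by (induction I rule: infinite_finite_induct) (auto intro: C1_fun_const C1_fun_add)

lemma C1_fun_mult:
  fixes f g :: "point \<Rightarrow> real"
  shows "C1_fun f \<Longrightarrow> C1_fun g \<Longrightarrow> C1_fun (\<lambda>x. f x * g x)"
  by (rule C1_fun_bilinear[OF bounded_bilinear_mult])

lemma C1_fun_power:
  fixes f :: "point \<Rightarrow> real"
  shows "C1_fun f \<Longrightarrow> C1_fun (\<lambda>x. f x ^ n)"
  by (induction n) (auto intro: C1_fun_const C1_fun_mult)

lemma C1_fun_prod:
  fixes f :: "'i \<Rightarrow> point \<Rightarrow> real"
  assumes "\<And>i. i \<in> I \<Longrightarrow> C1_fun (f i)"
  shows "C1_fun (\<lambda>x. \<Prod>i\<in>I. f i x)"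
  using assms by (induction I rule: infinite_finite_induct) (auto intro: C1_fun_const C1_fun_mult)

lemma C1_fun_vec:
  fixes f :: "point \<Rightarrow> real^'m"
  assumes "\<And>j. C1_fun (\<lambda>x. f x $ j)"
  shows "C1_fun f"
proof -
  have "f x = (\<Sum>j\<in>UNIV. f x $ j *\<^sub>R axis j 1)" for x
    by (simp add: vec_eq_iff axis_def if_distrib cong: if_cong)
  then have "f = (\<lambda>x. \<Sum>j\<in>UNIV. f x $ j *\<^sub>R axis j 1)" by blast
  moreover have "C1_fun \<dots>"
    by (intro C1_fun_sum C1_fun_bilinear[OF bounded_bilinear_scaleR] assms C1_fun_const)
  ultimately show ?thesis by simp
qed

lemma C1_fun_Vh:
  assumes "u \<in> Vh N \<T>" "D \<in> \<T>"
  shows "C1_fun (u D)"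
proof (rule C1_fun_vec)
  fix j
  have "(\<lambda>x. u D x $ j) \<in> poly_deg_le N" using assms by (auto simp: Vh_def)
  then show "C1_fun (\<lambda>x. u D x $ j)"
    by (auto simp: poly_deg_le_def intro!: C1_fun_sum C1_fun_mult C1_fun_const C1_fun_prod C1_fun_power C1_fun_nth)
qed

text \<open>
  A finite-dimensional space of functions on \<open>D\<close> is determined by finitely many point values;
  new nodes are added where the current interpolation error of the next function does not vanish.
\<close>

lemma finite_interpolation:
  fixes \<phi> :: "'i \<Rightarrow> 'x::topological_space \<Rightarrow> real"
  assumes "\<And>m. m \<in> M \<Longrightarrow> continuous_on UNIV (\<phi> m)"
  shows "\<exists>n y L. (\<forall>i<n::nat. y i \<in> D) \<and> (\<forall>i<n. continuous_on UNIV (L i)) \<and>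
    (\<forall>a. \<forall>x\<in>D. (\<Sum>m\<in>M. a m * \<phi> m x) = (\<Sum>i<n. (\<Sum>m\<in>M. a m * \<phi> m (y i)) * L i x))"
  using assms
proof (induction M rule: infinite_finite_induct)
  \<comment> \<open>A sum over an infinite set is 0 by convention, so no nodes are required.\<close>
  case (infinite M)
  then show ?case by (intro exI[of _ 0]) auto
next
  case empty
  then show ?case by (intro exI[of _ 0]) auto
next
  case (insert m M)
  have "continuous_on UNIV (\<phi> i)" if "i \<in> M" for i using insert.prems that by blast
  then have "\<exists>n y L. (\<forall>i<n::nat. y i \<in> D) \<and> (\<forall>i<n. continuous_on UNIV (L i)) \<and>
    (\<forall>a. \<forall>x\<in>D. (\<Sum>m\<in>M. a m * \<phi> m x) = (\<Sum>i<n. (\<Sum>m\<in>M. a m * \<phi> m (y i)) * L i x))"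
    by (rule insert.IH)
  then obtain n y L where y: "\<forall>i<n::nat. y i \<in> D" and L: "\<forall>i<n. continuous_on UNIV (L i)"
    and eq: "\<forall>a. \<forall>x\<in>D. (\<Sum>m\<in>M. a m * \<phi> m x) = (\<Sum>i<n. (\<Sum>m\<in>M. a m * \<phi> m (y i)) * L i x)"
    by blast
  \<comment> \<open>The interpolation error of the new function. The old functions are reproduced
    exactly on \<open>D\<close>, so the error of any combination \<open>q a\<close> is
    \<open>a m * r\<close>.\<close>
  define r where "r x = \<phi> m x - (\<Sum>i<n. \<phi> m (y i) * L i x)" for x
  have rc: "continuous_on UNIV r"
    unfolding r_def using insert.prems L by (intro continuous_intros) auto
  define q where "q a x = (\<Sum>m\<in>insert m M. a m * \<phi> m x)" for a x
  have err: "q a x - (\<Sum>i<n. q a (y i) * L i x) = a m * r x" if "x \<in> D" for a x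
    using insert.hyps eq[rule_format, OF that, of a]
    by (simp add: q_def r_def algebra_simps sum.distrib sum_distrib_left)
  show ?case
  proof (cases "\<forall>x\<in>D. r x = 0")
    case True
    then have "\<forall>a. \<forall>x\<in>D. q a x = (\<Sum>i<n. q a (y i) * L i x)" using err by force
    with y L show ?thesis unfolding q_def by blast
  next
    case False
    then obtain z where z: "z \<in> D" "r z \<noteq> 0" by blast
    define y' where "y' i = (if i < n then y i else z)" for i
    \<comment> \<open>Evaluating the error of \<open>q a\<close> at \<open>z\<close> and dividing by
      \<open>r z\<close> recovers the coefficient \<open>a m\<close>. Substituting this into the
      error formula and collecting the values at the old nodes and at \<open>z\<close> gives these
      weights.\<close>
    define L' where "L' i x = (if i < n then L i x - L i z * r x / r z else r x / r z)" for i x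
    have "q a x = (\<Sum>i<Suc n. q a (y' i) * L' i x)" if x: "x \<in> D" for a x
    proof -
      have "(\<Sum>i<Suc n. q a (y' i) * L' i x)
          = (\<Sum>i<n. q a (y i) * L i x) + r x / r z * (q a z - (\<Sum>i<n. q a (y i) * L i z))"
        by (simp add: y'_def L'_def algebra_simps sum_subtractf sum_distrib_left)
      also have "\<dots> = q a x" using err[OF x, of a] err[OF z(1), of a] z(2) by (simp add: algebra_simps)
      finally show ?thesis by simp
    qed
    moreover have "\<forall>i<Suc n. y' i \<in> D" using y z by (simp add: y'_def)
    moreover have "\<forall>i<Suc n. continuous_on UNIV (L' i)"
    proof (intro allI impI)
      fix i
      show "continuous_on UNIV (L' i)"
        using L rc z by (cases "i < n") (auto simp: L'_def intro!: continuous_intros)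
    qed
    ultimately show ?thesis unfolding q_def by blast
  qed
qed

text \<open>The nodes and weights are the same for all \<open>u\<close> and all components. This
  uniformity lets them stay fixed while a field varies in time.\<close>

lemma Vh_interpolation:
  assumes D: "D \<in> \<T>"
  shows "\<exists>(n::nat) y L. (\<forall>i<n. y i \<in> D) \<and> (\<forall>i<n. continuous_on UNIV (L i)) \<and>
    (\<forall>u \<in> Vh N \<T> :: (real^'m) broken set. \<forall>x\<in>D. u D x = (\<Sum>i<n. L i x *\<^sub>R u D (y i)))"
proof -
  let ?M = "{m :: nat^3. (\<Sum>i\<in>UNIV. m $ i) \<le> N}"
  let ?\<phi> = "\<lambda>m x :: point. \<Prod>i\<in>UNIV. x $ i ^ (m $ i)"
  have "continuous_on UNIV (?\<phi> m)" for m by (intro continuous_intros)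
  from finite_interpolation[of ?M ?\<phi> D, OF this]
  obtain n y L where nyL: "\<forall>i<n::nat. y i \<in> D" "\<forall>i<n. continuous_on UNIV (L i)"
    "\<forall>a. \<forall>x\<in>D. (\<Sum>m\<in>?M. a m * ?\<phi> m x) = (\<Sum>i<n. (\<Sum>m\<in>?M. a m * ?\<phi> m (y i)) * L i x)"
    by blast
  show ?thesis
  proof (intro exI[of _ n] exI[of _ y] exI[of _ L] conjI ballI nyL(1,2))
    fix u :: "(real^'m) broken" and x assume u: "u \<in> Vh N \<T>" and x: "x \<in> D"
    show "u D x = (\<Sum>i<n. L i x *\<^sub>R u D (y i))"
      unfolding vec_eq_iff
    proof
      fix j
      have "(\<lambda>x. u D x $ j) \<in> poly_deg_le N" using u D by (auto simp: Vh_def)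
      then obtain a where a: "(\<lambda>x. u D x $ j) = (\<lambda>x. \<Sum>m\<in>?M. a m * ?\<phi> m x)"
        unfolding poly_deg_le_def by blast
      then have a': "u D x $ j = (\<Sum>m\<in>?M. a m * ?\<phi> m x)" for x by meson
      have "u D x $ j = (\<Sum>i<n. u D (y i) $ j * L i x)"
        unfolding a' using nyL(3) x by blast
      then show "u D x $ j = (\<Sum>i<n. L i x *\<^sub>R u D (y i)) $ j"
        by (simp add: mult.commute)
    qed
  qed
qed

section \<open>The energy of an element as a finite quadratic form in nodal values\<close>

lemma vol_inner_sum:
  fixes M :: "point \<Rightarrow> real^'m^'m"
  assumes int: "\<And>f g. continuous_on UNIV f \<Longrightarrow> continuous_on UNIV g \<Longrightarrow>
      set_integrable lebesgue D (\<lambda>x. (M x *v f x) \<bullet> g x)"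
    and L: "\<And>i. i < n \<Longrightarrow> continuous_on UNIV (L i :: point \<Rightarrow> real)"
  shows "vol_inner D (\<lambda>x. M x *v (\<Sum>i<n. L i x *\<^sub>R a i)) (\<lambda>x. \<Sum>j<n. L j x *\<^sub>R b j)
    = (\<Sum>i<n. \<Sum>j<n. vol_inner D (\<lambda>x. M x *v (L i x *\<^sub>R a i)) (\<lambda>x. L j x *\<^sub>R b j))"
proof -
  have int': "integrable lebesgue (\<lambda>x. indicator D x *\<^sub>R ((M x *v (L i x *\<^sub>R a i)) \<bullet> (L j x *\<^sub>R b j)))"
    if "i < n" "j < n" for i j
    unfolding set_integrable_def[symmetric] using that L by (intro int continuous_intros)
  have "(M x *v (\<Sum>i<n. L i x *\<^sub>R a i)) \<bullet> (\<Sum>j<n. L j x *\<^sub>R b j)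
      = (\<Sum>i<n. \<Sum>j<n. (M x *v (L i x *\<^sub>R a i)) \<bullet> (L j x *\<^sub>R b j))" for x
    by (simp only: linear_sum[OF matrix_vector_mul_linear] inner_sum_left inner_sum_right) (rule sum.swap)
  then show ?thesis
    unfolding vol_inner_def set_lebesgue_integral_def using int'
    by (simp only: scaleR_sum_right) (subst Bochner_Integration.integral_sum; auto intro!: sum.cong)
qed

text \<open>A bilinear form on a finite-dimensional space is bounded, so the product rule applies to
  it directly and no limit has to pass under the integral sign.\<close>

lemma bounded_bilinear_vol_inner:
  fixes M :: "point \<Rightarrow> real^'m^'m"
  assumes int: "\<And>f g. continuous_on UNIV f \<Longrightarrow> continuous_on UNIV g \<Longrightarrow>
      set_integrable lebesgue D (\<lambda>x. (M x *v f x) \<bullet> g x)"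
    and l: "continuous_on UNIV l" and k: "continuous_on UNIV k"
  shows "bounded_bilinear (\<lambda>a b. vol_inner D (\<lambda>x. M x *v (l x *\<^sub>R a)) (\<lambda>x. k x *\<^sub>R b))"
proof -
  have int': "set_integrable lebesgue D (\<lambda>x. (M x *v (l x *\<^sub>R a)) \<bullet> (k x *\<^sub>R b))" for a b
    by (intro int continuous_intros l k)
  note lin = linear_add[OF matrix_vector_mul_linear] linear_scale[OF matrix_vector_mul_linear]
  show ?thesis
    unfolding bilinear_conv_bounded_bilinear[symmetric] bilinear_def
  proof (intro conjI allI linearI)
    fix a b c :: "real^'m" and r :: real
    show "vol_inner D (\<lambda>x. M x *v (l x *\<^sub>R a)) (\<lambda>x. k x *\<^sub>R (b + c)) =
        vol_inner D (\<lambda>x. M x *v (l x *\<^sub>R a)) (\<lambda>x. k x *\<^sub>R b) + vol_inner D (\<lambda>x. M x *v (l x *\<^sub>R a)) (\<lambda>x. k x *\<^sub>R c)"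
      unfolding vol_inner_def set_integral_add(2)[OF int' int', symmetric]
      by (simp add: scaleR_add_right inner_add_right)
    show "vol_inner D (\<lambda>x. M x *v (l x *\<^sub>R (b + c))) (\<lambda>x. k x *\<^sub>R a) =
        vol_inner D (\<lambda>x. M x *v (l x *\<^sub>R b)) (\<lambda>x. k x *\<^sub>R a) + vol_inner D (\<lambda>x. M x *v (l x *\<^sub>R c)) (\<lambda>x. k x *\<^sub>R a)"
      unfolding vol_inner_def set_integral_add(2)[OF int' int', symmetric]
      by (simp only: scaleR_add_right lin inner_add_left)
    have eq: "(M x *v (l x *\<^sub>R a)) \<bullet> (k x *\<^sub>R (r *\<^sub>R b)) = r * ((M x *v (l x *\<^sub>R a)) \<bullet> (k x *\<^sub>R b))"
      "(M x *v (l x *\<^sub>R (r *\<^sub>R b))) \<bullet> (k x *\<^sub>R a) = r * ((M x *v (l x *\<^sub>R b)) \<bullet> (k x *\<^sub>R a))" for x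
      by (simp_all only: lin inner_scaleR_left inner_scaleR_right mult_ac)
    show "vol_inner D (\<lambda>x. M x *v (l x *\<^sub>R a)) (\<lambda>x. k x *\<^sub>R (r *\<^sub>R b)) =
        r *\<^sub>R vol_inner D (\<lambda>x. M x *v (l x *\<^sub>R a)) (\<lambda>x. k x *\<^sub>R b)"
      and "vol_inner D (\<lambda>x. M x *v (l x *\<^sub>R (r *\<^sub>R b))) (\<lambda>x. k x *\<^sub>R a) =
        r *\<^sub>R vol_inner D (\<lambda>x. M x *v (l x *\<^sub>R b)) (\<lambda>x. k x *\<^sub>R a)"
      unfolding vol_inner_def eq by (simp_all only: set_integral_mult_right real_scaleR_def)
  qed
qed

lemma vol_inner_cong:
  assumes "compact D" "\<And>x. x \<in> D \<Longrightarrow> f x \<bullet> g x = f' x \<bullet> g' x"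
  shows "vol_inner D f g = vol_inner D f' g'"
  unfolding vol_inner_def using assms
  by (intro set_lebesgue_integral_cong) (auto simp: compact_imp_closed)

text \<open>The energy is a quadratic form in the nodal values \<open>u s D (y i)\<close>, each of
  which is differentiable in time. The product rule yields two double sums, which symmetry
  identifies, hence the factor 2. Symmetry is assumed for integrals because \<open>M\<close> may
  fail to be symmetric on a null part of \<open>D\<close>.\<close>

lemma energy_has_vector_derivative:
  fixes M :: "point \<Rightarrow> real^'m^'m" and u :: "real \<Rightarrow> (real^'m) broken"
  assumes D: "compact D" "D \<in> \<T>"
    and int: "\<And>f g. continuous_on UNIV f \<Longrightarrow> continuous_on UNIV g \<Longrightarrow>
      set_integrable lebesgue D (\<lambda>x. (M x *v f x) \<bullet> g x)"
    and sym: "\<And>f g. continuous_on UNIV f \<Longrightarrow> continuous_on UNIV g \<Longrightarrow>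
      vol_inner D (\<lambda>x. M x *v f x) g = vol_inner D (\<lambda>x. M x *v g x) f"
    and u: "\<And>s. s \<in> J \<Longrightarrow> u s \<in> Vh N \<T>" and C1: "C1_in_time J \<T> u"
    and t: "t \<in> J" "at t within J \<noteq> bot"
  shows "((\<lambda>s. vol_inner D (\<lambda>x. M x *v u s D x) (u s D)) has_vector_derivative
    2 * vol_inner D (\<lambda>x. M x *v time_deriv J u t D x) (u t D)) (at t within J)"
proof -
  obtain n y L where y': "\<forall>i<n::nat. y i \<in> D" and L': "\<forall>i<n. continuous_on UNIV (L i)"
    and interp: "\<forall>u \<in> Vh N \<T> :: (real^'m) broken set. \<forall>x\<in>D. u D x = (\<Sum>i<n. L i x *\<^sub>R u D (y i))"
    using Vh_interpolation[OF D(2), of N] by blast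
  have y: "y i \<in> D" and L: "continuous_on UNIV (L i)" if "i < n" for i
    using y' L' that by auto
  have rep: "u s D x = (\<Sum>i<n. L i x *\<^sub>R u s D (y i))" if "s \<in> J" "x \<in> D" for s x
    using interp u that by blast
  define c' where "c' i = time_deriv J u t D (y i)" for i
  have c': "((\<lambda>s. u s D x) has_vector_derivative time_deriv J u t D x) (at t within J)" if x: "x \<in> D" for x
  proof -
    obtain u' where "((\<lambda>s. u s D x) has_vector_derivative u' t) (at t within J)"
      using C1 D(2) t(1) x unfolding C1_in_time_def by blast
    then show ?thesis
      unfolding time_deriv_def using vector_derivative_within[OF t(2)] by metis
  qed
  \<comment> \<open>The time derivative has the same expansion in its own nodal values, by
    uniqueness of derivatives within \<open>J\<close>. It can therefore be inserted into the same
    finite form.\<close>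
  have rep': "time_deriv J u t D x = (\<Sum>i<n. L i x *\<^sub>R c' i)" if x: "x \<in> D" for x
  proof -
    have "((\<lambda>s. \<Sum>i<n. L i x *\<^sub>R u s D (y i)) has_vector_derivative (\<Sum>i<n. L i x *\<^sub>R c' i)) (at t within J)"
      unfolding c'_def using y
      by (intro has_vector_derivative_sum bounded_linear.has_vector_derivative[OF bounded_linear_scaleR_right] c') auto
    then have "((\<lambda>s. u s D x) has_vector_derivative (\<Sum>i<n. L i x *\<^sub>R c' i)) (at t within J)"
      by (rule has_vector_derivative_transform[OF t(1), rotated]) (simp add: rep x)
    then show ?thesis
      using c'[OF x] vector_derivative_unique_within[OF t(2)] by blast
  qed
  let ?B = "\<lambda>i j a b. vol_inner D (\<lambda>x. M x *v (L i x *\<^sub>R a)) (\<lambda>x. L j x *\<^sub>R b)"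
  have exp0: "vol_inner D (\<lambda>x. M x *v (\<Sum>i<n. L i x *\<^sub>R a i)) (\<lambda>x. \<Sum>j<n. L j x *\<^sub>R b j)
    = (\<Sum>i<n. \<Sum>j<n. ?B i j (a i) (b j))" for a b
    by (rule vol_inner_sum) (use int L in auto)
  have exp: "vol_inner D (\<lambda>x. M x *v f x) g = (\<Sum>i<n. \<Sum>j<n. ?B i j (a i) (b j))"
    if "\<And>x. x \<in> D \<Longrightarrow> f x = (\<Sum>i<n. L i x *\<^sub>R a i)" "\<And>x. x \<in> D \<Longrightarrow> g x = (\<Sum>i<n. L i x *\<^sub>R b i)" for f g a b
    unfolding exp0[symmetric] using that by (intro vol_inner_cong D) simp
  have "((\<lambda>s. \<Sum>i<n. \<Sum>j<n. ?B i j (u s D (y i)) (u s D (y j))) has_vector_derivative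
     (\<Sum>i<n. \<Sum>j<n. ?B i j (u t D (y i)) (c' j) + ?B i j (c' i) (u t D (y j)))) (at t within J)"
    unfolding c'_def
    by (intro has_vector_derivative_sum bounded_bilinear.has_vector_derivative
        bounded_bilinear_vol_inner int L c' y) auto
  then have "((\<lambda>s. vol_inner D (\<lambda>x. M x *v u s D x) (u s D)) has_vector_derivative
     (\<Sum>i<n. \<Sum>j<n. ?B i j (u t D (y i)) (c' j) + ?B i j (c' i) (u t D (y j)))) (at t within J)"
    by (rule has_vector_derivative_transform[OF t(1), rotated]) (rule exp, auto intro: rep)
  moreover have "(\<Sum>i<n. \<Sum>j<n. ?B i j (u t D (y i)) (c' j) + ?B i j (c' i) (u t D (y j)))
    = 2 * vol_inner D (\<lambda>x. M x *v time_deriv J u t D x) (u t D)"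
  proof -
    have "(\<Sum>i<n. \<Sum>j<n. ?B i j (u t D (y i)) (c' j)) = (\<Sum>i<n. \<Sum>j<n. ?B i j (c' i) (u t D (y j)))"
      unfolding exp0[symmetric]
      by (intro sym continuous_intros) (use L in auto)
    moreover have "vol_inner D (\<lambda>x. M x *v time_deriv J u t D x) (u t D)
        = (\<Sum>i<n. \<Sum>j<n. ?B i j (c' i) (u t D (y j)))"
      by (rule exp) (auto intro: rep rep' t)
    ultimately show ?thesis by (simp add: sum.distrib)
  qed
  ultimately show ?thesis by simp
qed

section \<open>Coefficient fields\<close>

lemma AE_not_frontier_convex:
  assumes "convex (D :: 'a::euclidean_space set)"
  shows "AE x in lebesgue. x \<notin> frontier D"
  using negligible_convex_frontier[OF assms] by (auto simp: negligible_iff_null_sets intro: AE_not_in)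

text \<open>Nothing is known about \<open>c\<close> at points of \<open>D\<close> outside
  \<open>\<Omega>\<close>. Integrability is obtained on the interior, where a bounded measurable
  function on a bounded set is integrable, and the null set \<open>D - interior D\<close> is then
  added.\<close>

lemma set_integrable_coefficient:
  fixes c \<phi> :: "point \<Rightarrow> real"
  assumes D: "compact D" "convex D" "interior D \<subseteq> \<Omega>"
    and c: "c \<in> borel_measurable (lebesgue_on \<Omega>)" and B: "\<And>x. x \<in> \<Omega> \<Longrightarrow> \<bar>c x\<bar> \<le> B"
    and \<phi>: "continuous_on UNIV \<phi>"
  shows "set_integrable lebesgue D (\<lambda>x. c x * \<phi> x)"
proof -
  have "bounded (\<phi> ` D)"
    by (intro compact_imp_bounded compact_continuous_image D continuous_on_subset[OF \<phi>]) auto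
  then obtain K where K: "\<And>x. x \<in> D \<Longrightarrow> \<bar>\<phi> x\<bar> \<le> K" by (auto simp: bounded_iff)
  have U: "interior D \<in> sets lebesgue" by (intro borel_open sets_completionI_sets) auto
  have "\<phi> \<in> borel_measurable (lebesgue_on (interior D))"
    by (intro measurable_restrict_space1 measurable_completion)
      (simp add: borel_measurable_continuous_onI \<phi>)
  moreover have "c \<in> borel_measurable (lebesgue_on (interior D))"
    using c D(3) by (rule measurable_restrict_mono)
  ultimately have "(\<lambda>x. c x * \<phi> x) \<in> borel_measurable (lebesgue_on (interior D))"
    by (rule borel_measurable_times[rotated])
  then have m: "(\<lambda>x. indicator (interior D) x *\<^sub>R (c x * \<phi> x)) \<in> borel_measurable lebesgue"
    using U by (subst (asm) borel_measurable_restrict_space_iff) auto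
  have "integrable lebesgue (\<lambda>x. indicator (interior D) x *\<^sub>R (indicator (interior D) x *\<^sub>R (c x * \<phi> x)))"
  proof (rule integrableI_bounded_set_indicator[OF U m, where B = "B * K"])
    have "bounded (interior D)" using D(1) by (meson bounded_interior compact_imp_bounded)
    then show "emeasure lebesgue (interior D) < \<infinity>"
      using emeasure_bounded_finite[of "interior D"] by simp
    have "norm (c x * \<phi> x) \<le> B * K" if "x \<in> interior D" for x
    proof -
      have "x \<in> D" "x \<in> \<Omega>" using that D(3) interior_subset by auto
      then show ?thesis using B K by (auto simp: abs_mult intro!: mult_mono order_trans[OF abs_ge_zero])
    qed
    then show "AE x in lebesgue. x \<in> interior D \<longrightarrow> norm (indicator (interior D) x *\<^sub>R (c x * \<phi> x)) \<le> B * K"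
      by (auto simp: indicator_def)
  qed
  moreover have "(\<lambda>x. indicator (interior D) x *\<^sub>R (indicator (interior D) x *\<^sub>R (c x * \<phi> x)))
      = (\<lambda>x. indicator (interior D) x *\<^sub>R (c x * \<phi> x))"
    by (auto simp: indicator_def)
  ultimately have int: "set_integrable lebesgue (interior D) (\<lambda>x. c x * \<phi> x)"
    by (simp only: set_integrable_def)
  have "D \<subseteq> interior D \<union> frontier D" using closure_subset[of D] by (auto simp: frontier_def)
  then have "D - interior D \<subseteq> frontier D" by auto
  then have neg: "negligible (D - interior D)"
    by (rule negligible_subset[OF negligible_convex_frontier[OF D(2)]])
  show ?thesis
  proof (rule absolutely_integrable_spike_set[OF int])
    show "negligible {x \<in> D - interior D. c x * \<phi> x \<noteq> 0}"
      by (rule negligible_subset[OF neg]) auto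
    show "negligible {x \<in> interior D - D. c x * \<phi> x \<noteq> 0}"
      by (rule negligible_subset[OF neg]) (use interior_subset in auto)
  qed
qed

text \<open>A common form for the inverse stiffness, the density as a scalar matrix, and the
  relaxation matrix. The bound is entrywise because integrands are expanded into products of entries
  and components.\<close>

definition bounded_coefficient :: "point set \<Rightarrow> (point \<Rightarrow> real^'m^'n) \<Rightarrow> bool" where
  "bounded_coefficient \<Omega> M \<longleftrightarrow> M \<in> borel_measurable (lebesgue_on \<Omega>) \<and>
     (\<exists>B. \<forall>x\<in>\<Omega>. \<forall>i j. \<bar>M x $ i $ j\<bar> \<le> B)"

lemma bounded_coefficient_integrable:
  fixes M :: "point \<Rightarrow> real^'m^'n"
  assumes D: "3 simplex D" "interior D \<subseteq> \<Omega>" and M: "bounded_coefficient \<Omega> M"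
    and f: "continuous_on UNIV f" and g: "continuous_on UNIV g"
  shows "set_integrable lebesgue D (\<lambda>x. (M x *v f x) \<bullet> g x)"
proof -
  obtain B where B: "\<And>x i j. x \<in> \<Omega> \<Longrightarrow> \<bar>M x $ i $ j\<bar> \<le> B"
    using M unfolding bounded_coefficient_def by blast
  have "(\<lambda>A :: real^'m^'n. A $ i $ j) \<in> borel_measurable borel" for i j
    by (intro borel_measurable_continuous_onI continuous_intros)
  moreover have "M \<in> borel_measurable (lebesgue_on \<Omega>)" using M by (simp add: bounded_coefficient_def)
  ultimately have m: "(\<lambda>x. M x $ i $ j) \<in> borel_measurable (lebesgue_on \<Omega>)" for i j
    by (rule measurable_compose[rotated])
  have "set_integrable lebesgue D (\<lambda>x. M x $ i $ j * (f x $ j * g x $ i))" for i j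
    by (rule set_integrable_coefficient[OF three_simplex_props(1,2)[OF D(1)] D(2) m])
      (auto intro!: B continuous_intros f g)
  then have "set_integrable lebesgue D (\<lambda>x. \<Sum>i\<in>UNIV. \<Sum>j\<in>UNIV. M x $ i $ j * (f x $ j * g x $ i))"
    unfolding set_integrable_def scaleR_sum_right by (intro Bochner_Integration.integrable_sum)
  then show ?thesis
    by (simp add: inner_vec_def matrix_vector_mult_def sum_distrib_right sum_distrib_left mult_ac)
qed

text \<open>Pointwise symmetry is available on \<open>\<Omega>\<close>, which contains
  \<open>D\<close> up to the null frontier; the integrands agree almost everywhere.\<close>

lemma vol_inner_symmetric:
  fixes M :: "point \<Rightarrow> real^'m^'m"
  assumes D: "3 simplex D" "interior D \<subseteq> \<Omega>" and M: "bounded_coefficient \<Omega> M"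
    and sym: "\<And>x. x \<in> \<Omega> \<Longrightarrow> transpose (M x) = M x"
    and f: "continuous_on UNIV f" and g: "continuous_on UNIV g"
  shows "vol_inner D (\<lambda>x. M x *v f x) g = vol_inner D (\<lambda>x. M x *v g x) f"
proof -
  note D' = three_simplex_props[OF D(1)]
  have int: "integrable lebesgue (\<lambda>x. indicator D x *\<^sub>R ((M x *v f x) \<bullet> g x))"
    "integrable lebesgue (\<lambda>x. indicator D x *\<^sub>R ((M x *v g x) \<bullet> f x))"
    using bounded_coefficient_integrable[OF D M f g] bounded_coefficient_integrable[OF D M g f]
    by (simp_all add: set_integrable_def)
  have eq: "(M x *v f x) \<bullet> g x = (M x *v g x) \<bullet> f x" if "x \<in> interior D" for x
  proof -
    have "(M x *v f x) \<bullet> g x = (transpose (M x) *v f x) \<bullet> g x" 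
      using that D(2) by (simp only: sym subsetD)
    also have "\<dots> = f x \<bullet> (M x *v g x)" by (simp add: dot_lmul_matrix)
    finally show ?thesis by (simp add: inner_commute)
  qed
  show ?thesis
    unfolding vol_inner_def set_lebesgue_integral_def
  proof (rule integral_cong_AE)
    show "AE x in lebesgue. indicator D x *\<^sub>R ((M x *v f x) \<bullet> g x) = indicator D x *\<^sub>R ((M x *v g x) \<bullet> f x)"
      using AE_not_frontier_convex[OF D'(2)]
    proof eventually_elim
      case (elim x)
      then show ?case
        using eq[of x] closure_subset[of D] by (auto simp: frontier_def indicator_def)
    qed
  qed (use int in auto)
qed

section \<open>Symmetry and bounds of the coefficient matrices\<close>

lemma exhaust_6:
  fixes x :: 6
  shows "x = 1 \<or> x = 2 \<or> x = 3 \<or> x = 4 \<or> x = 5 \<or> x = 6"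
proof (induct x)
  case (of_int z)
  \<comment> \<open>Representatives range from 0 to 5, and \<open>6 = 0\<close> in this type, so
    \<open>z = 0\<close> is the last alternative of the claim.\<close>
  then have "z = 0 \<or> z = 1 \<or> z = 2 \<or> z = 3 \<or> z = 4 \<or> z = 5" by fastforce
  then show ?case by auto
qed

lemma forall_6: "(\<forall>i::6. P i) \<longleftrightarrow> P 1 \<and> P 2 \<and> P 3 \<and> P 4 \<and> P 5 \<and> P 6"
  by (metis exhaust_6)

lemma vector_6:
  "(vector [x1, x2, x3, x4, x5, x6] :: 'a::zero^6) $ 1 = x1"
  "(vector [x1, x2, x3, x4, x5, x6] :: 'a::zero^6) $ 2 = x2"
  "(vector [x1, x2, x3, x4, x5, x6] :: 'a::zero^6) $ 3 = x3"
  "(vector [x1, x2, x3, x4, x5, x6] :: 'a::zero^6) $ 4 = x4"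
  "(vector [x1, x2, x3, x4, x5, x6] :: 'a::zero^6) $ 5 = x5"
  "(vector [x1, x2, x3, x4, x5, x6] :: 'a::zero^6) $ 6 = x6"
  unfolding vector_def by simp_all

lemma transpose_stiffness:
  "transpose (stiffness c11 c12 c13 c22 c33 c44 c55 c66) = stiffness c11 c12 c13 c22 c33 c44 c55 c66"
  unfolding vec_eq_iff transpose_def stiffness_def vec_lambda_beta forall_6 vector_6 by simp

lemma transpose_block_diag: "transpose (block_diag M N) = block_diag (transpose M) (transpose N)"
  by (auto simp: vec_eq_iff transpose_def block_diag_def split: sum.splits)

text \<open>Transposing \<open>A ** matrix_inv A = mat 1\<close> turns the transposed inverse into a
  left inverse of the symmetric matrix \<open>A\<close>; a left inverse equals the right
  inverse.\<close>

lemma transpose_matrix_inv: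
  fixes A :: "real^'n^'n"
  assumes "invertible A" "transpose A = A"
  shows "transpose (matrix_inv A) = matrix_inv A"
proof -
  have inv: "A ** matrix_inv A = mat 1" "matrix_inv A ** A = mat 1"
    using assms(1) unfolding invertible_def matrix_inv_def by (metis (mono_tags, lifting) someI_ex)+
  have "transpose (matrix_inv A) ** A = mat 1"
    using arg_cong[OF inv(1), of transpose] assms(2) by (simp add: matrix_transpose_mul transpose_mat)
  then have "matrix_inv A = transpose (matrix_inv A) ** A ** matrix_inv A" by simp
  also have "\<dots> = transpose (matrix_inv A)" by (simp add: matrix_mul_assoc[symmetric] inv)
  finally show ?thesis by simp
qed

text \<open>A kernel vector of \<open>C\<close>, padded with zeros in the memory components, is a
  kernel vector of \<open>Qs C\<close>, which positivity excludes. Invertibility gives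
  \<open>matrix_inv (Cp x)\<close> its meaning as an inverse.\<close>

lemma invertible_Qs_block:
  assumes pos: "\<And>u. norm u = 1 \<Longrightarrow> 0 < u \<bullet> (Qs C *v u)"
  shows "invertible C"
proof -
  have "x = 0" if x: "C *v x = 0" for x
  proof (rule ccontr)
    assume nz: "x \<noteq> 0"
    define w :: "real^state_index" where "w = (\<chi> i. case i of Inl a \<Rightarrow> x $ a | Inr b \<Rightarrow> 0)"
    have "(Qs C *v w) $ i = 0" for i
    proof (cases i)
      case (Inl a)
      have "(Qs C *v w) $ i = (\<Sum>j\<in>UNIV <+> UNIV. Qs C $ i $ j * w $ j)"
        by (simp add: matrix_vector_mult_def)
      also have "\<dots> = (\<Sum>b\<in>UNIV. C $ a $ b * x $ b)"
        by (subst sum.Plus) (simp_all add: Qs_def block_diag_def w_def Inl)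
      also have "\<dots> = (C *v x) $ a" by (simp add: matrix_vector_mult_def)
      finally show ?thesis using x by simp
    next
      case (Inr a)
      have "(Qs C *v w) $ i = (\<Sum>j\<in>UNIV <+> UNIV. Qs C $ i $ j * w $ j)"
        by (simp add: matrix_vector_mult_def)
      also have "\<dots> = 0"
        by (subst sum.Plus) (simp_all add: Qs_def block_diag_def w_def Inr)
      finally show ?thesis .
    qed
    then have Qw: "Qs C *v w = 0" by (simp add: vec_eq_iff)
    obtain a where "x $ a \<noteq> 0" using nz by (auto simp: vec_eq_iff)
    then have "w $ Inl a \<noteq> 0" by (simp add: w_def)
    then have w: "w \<noteq> 0" by auto
    have "Qs C *v (inverse (norm w) *\<^sub>R w) = 0"
      by (simp only: linear_scale[OF matrix_vector_mul_linear] Qw) simp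
    moreover have "norm (inverse (norm w) *\<^sub>R w) = 1" using w by simp
    ultimately show False using pos[of "inverse (norm w) *\<^sub>R w"] by simp
  qed
  then show ?thesis
    unfolding invertible_left_inverse matrix_left_invertible_ker by blast
qed

text \<open>Polarization: the entries are differences of values of the quadratic form.\<close>

lemma uniformly_pos_def_on_entries_bounded:
  fixes M :: "'x \<Rightarrow> real^'n^'n"
  assumes pd: "uniformly_pos_def_on X M" and sym: "\<And>x. x \<in> X \<Longrightarrow> transpose (M x) = M x"
  shows "\<exists>B. \<forall>x\<in>X. \<forall>i j. \<bar>M x $ i $ j\<bar> \<le> B"
proof -
  obtain lo hi where lh: "0 < lo" "\<And>x u. x \<in> X \<Longrightarrow> norm u = 1 \<Longrightarrow> lo \<le> u \<bullet> (M x *v u)"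
    "\<And>x u. x \<in> X \<Longrightarrow> norm u = 1 \<Longrightarrow> u \<bullet> (M x *v u) \<le> hi"
    using pd unfolding uniformly_pos_def_on_def by blast
  \<comment> \<open>Homogeneity of degree two extends the bounds from unit vectors to all
    vectors.\<close>
  have q: "0 \<le> u \<bullet> (M x *v u) \<and> u \<bullet> (M x *v u) \<le> hi * (norm u)\<^sup>2" if x: "x \<in> X" for x u
  proof (cases "u = 0")
    case False
    define e where "e = inverse (norm u) *\<^sub>R u"
    have e: "norm e = 1" "u = norm u *\<^sub>R e" using False by (simp_all add: e_def)
    have "u \<bullet> (M x *v u) = (norm u)\<^sup>2 * (e \<bullet> (M x *v e))"
      by (subst (1 2) e(2)) (simp add: linear_scale[OF matrix_vector_mul_linear] power2_eq_square)
    moreover have "0 \<le> e \<bullet> (M x *v e)" "e \<bullet> (M x *v e) \<le> hi" using lh x e(1) by force+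
    ultimately show ?thesis by (auto intro: mult_right_mono simp: mult.commute)
  qed simp
  have "\<bar>M x $ i $ j\<bar> \<le> \<bar>hi\<bar>" if x: "x \<in> X" for x i j
  proof -
    let ?i = "axis i 1 :: real^'n" and ?j = "axis j 1 :: real^'n"
    have ent: "axis k 1 \<bullet> (M x *v axis l 1) = M x $ k $ l" for k l
      by (simp add: inner_axis' matrix_vector_mul_component inner_axis)
    have s: "M x $ j $ i = M x $ i $ j"
      using arg_cong[OF sym[OF x], of "\<lambda>A. A $ i $ j"] by (simp add: transpose_def)
    \<comment> \<open>The squared norms are at most 4. Both values of the form lie between 0 and
      \<open>4 * \<bar>hi\<bar>\<close>, and their difference is four times the entry, so the
      factors 4 cancel.\<close>
    have n: "norm (?i + ?j) \<le> 2" "norm (?i - ?j) \<le> 2"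
      using norm_triangle_ineq[of ?i ?j] norm_triangle_ineq4[of ?i ?j] by simp_all
    then have n2: "(norm (?i + ?j))\<^sup>2 \<le> 4" "(norm (?i - ?j))\<^sup>2 \<le> 4"
      using power_mono[OF n(1), of 2] power_mono[OF n(2), of 2] by simp_all
    have h: "hi * (norm (?i + ?j))\<^sup>2 \<le> \<bar>hi\<bar> * 4" "hi * (norm (?i - ?j))\<^sup>2 \<le> \<bar>hi\<bar> * 4"
      using n2 by (auto intro!: mult_mono)
    have "(?i + ?j) \<bullet> (M x *v (?i + ?j)) - (?i - ?j) \<bullet> (M x *v (?i - ?j)) = 4 * M x $ i $ j"
      by (simp only: matrix_vector_right_distrib matrix_vector_mult_diff_distrib
          inner_add_left inner_add_right inner_diff_left inner_diff_right ent s)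
    with q[OF x, of "?i + ?j"] q[OF x, of "?i - ?j"] h show ?thesis by linarith
  qed
  then show ?thesis by blast
qed

lemma mat_mult_vector: "mat k *v x = k *\<^sub>R (x :: real^'n)"
  by (simp add: vec_eq_iff matrix_vector_mult_def mat_def if_distrib if_distribR cong: if_cong)

text \<open>Symmetry of the inverse is inherited from the shape of the stiffness matrix through
  inversion and the block structure, and it is what makes polarization give the bound. Writing the
  density as \<open>mat (\<rho> x)\<close> lets one energy lemma serve both fields.\<close>

lemma admissible_coefficients_consequences:
  assumes "admissible_coefficients \<Omega> Cp \<rho> S"
  shows "bounded_coefficient \<Omega> (\<lambda>x. Qs_inv (Cp x))"
    and "\<And>x. x \<in> \<Omega> \<Longrightarrow> transpose (Qs_inv (Cp x)) = Qs_inv (Cp x)"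
    and "bounded_coefficient \<Omega> (\<lambda>x. mat (\<rho> x) :: real^3^3)"
    and "bounded_coefficient \<Omega> S"
    and "\<And>x u. x \<in> \<Omega> \<Longrightarrow> u \<bullet> (S x *v u) \<le> 0"
proof -
  note a = assms[unfolded admissible_coefficients_def]
  show sym: "transpose (Qs_inv (Cp x)) = Qs_inv (Cp x)" if x: "x \<in> \<Omega>" for x
  proof -
    have "transpose (Cp x) = Cp x" using a x transpose_stiffness by metis
    moreover have "invertible (Cp x)"
    proof (rule invertible_Qs_block)
      fix u :: "real^state_index" assume "norm u = 1"
      with a x show "0 < u \<bullet> (Qs (Cp x) *v u)"
        unfolding uniformly_pos_def_on_def by (meson less_le_trans)
    qed
    ultimately show ?thesis
      by (simp add: Qs_inv_def transpose_block_diag transpose_matrix_inv transpose_mat)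
  qed
  show "bounded_coefficient \<Omega> (\<lambda>x. Qs_inv (Cp x))"
    unfolding bounded_coefficient_def
    using a uniformly_pos_def_on_entries_bounded[of \<Omega> "\<lambda>x. Qs_inv (Cp x)"] sym by blast
  obtain r R where r: "0 < r" "\<And>x. x \<in> \<Omega> \<Longrightarrow> r \<le> \<rho> x \<and> \<rho> x \<le> R" using a by blast
  have "(\<lambda>k. mat k :: real^3^3) \<in> borel_measurable borel"
    unfolding mat_def
  proof (intro borel_measurable_continuous_onI continuous_intros)
    fix i j :: 3
    show "continuous_on UNIV (\<lambda>k::real. if i = j then k else 0)"
      by (cases "i = j") (auto intro: continuous_intros)
  qed
  moreover have "\<rho> \<in> borel_measurable (lebesgue_on \<Omega>)" using a by blast
  ultimately have "(\<lambda>x. mat (\<rho> x) :: real^3^3) \<in> borel_measurable (lebesgue_on \<Omega>)"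
    by (rule measurable_compose[rotated])
  moreover have "\<bar>(mat (\<rho> x) :: real^3^3) $ i $ j\<bar> \<le> \<bar>R\<bar>" if "x \<in> \<Omega>" for x i j
    using r(1) r(2)[OF that] by (auto simp: mat_def)
  ultimately show "bounded_coefficient \<Omega> (\<lambda>x. mat (\<rho> x) :: real^3^3)"
    unfolding bounded_coefficient_def by blast
  have "bounded (S ` \<Omega>)" using a by blast
  then obtain B where B: "\<And>x. x \<in> \<Omega> \<Longrightarrow> norm (S x) \<le> B" unfolding bounded_iff by blast
  have "\<bar>S x $ i $ j\<bar> \<le> B" if "x \<in> \<Omega>" for x i j
    using component_le_norm_cart[of "S x $ i" j] Finite_Cartesian_Product.norm_nth_le[of "S x" i] B[OF that] by linarith
  then show "bounded_coefficient \<Omega> S" using a unfolding bounded_coefficient_def by blast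
  show "\<And>x u. x \<in> \<Omega> \<Longrightarrow> u \<bullet> (S x *v u) \<le> 0" using a by blast
qed

section \<open>Fluxes on faces\<close>

lemma An_mult_vector: "An n *v w = (\<Sum>i\<in>UNIV. n $ i *\<^sub>R (Amat i *v w))"
proof -
  have "(\<Sum>k\<in>UNIV. (\<Sum>i\<in>UNIV. n $ i * Amat i $ r $ k) * w $ k)
      = (\<Sum>i\<in>UNIV. n $ i * (\<Sum>k\<in>UNIV. Amat i $ r $ k * w $ k))" for r
    by (simp only: sum_distrib_left sum_distrib_right mult.assoc) (rule sum.swap)
  then show ?thesis by (simp add: An_def vec_eq_iff matrix_vector_mult_def)
qed

lemma An_uminus: "An (- n) = - An n"
  by (simp add: An_def sum_negf)

lemma matrix_vector_adjoint:
  fixes B :: "real^'n^'m"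
  shows "(B *v y) \<bullet> s = y \<bullet> (transpose B *v s)"
  by (metis dot_lmul_matrix inner_commute transpose_matrix_vector)

lemma divergence_An:
  fixes s :: "point \<Rightarrow> real^state_index" and w :: "point \<Rightarrow> real^3"
  assumes D: "3 simplex D" and s: "C1_fun s" and w: "C1_fun w"
  shows "vol_inner D (\<lambda>x. \<Sum>i\<in>UNIV. Amat i *v partial i w x) s +
      vol_inner D (\<lambda>x. \<Sum>i\<in>UNIV. transpose (Amat i) *v partial i s x) w =
    (\<Sum>F | F facet_of D. face_integral F (\<lambda>x. (An (outward_normal D F) *v w x) \<bullet> s x))"
proof -
  note c = C1_fun_continuous_on[OF s] C1_fun_continuous_on[OF w]
    C1_fun_frechet_derivative(2)[OF s] C1_fun_frechet_derivative(2)[OF w]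
  note cm = bounded_linear.continuous_on[OF matrix_vector_mul_bounded_linear]
  define G where "G i x = (Amat i *v w x) \<bullet> s x" for i x
  define G' where "G' i x h = (Amat i *v w x) \<bullet> frechet_derivative s (at x) h
    + (Amat i *v frechet_derivative w (at x) h) \<bullet> s x" for i x h
  have der: "(G i has_derivative G' i x) (at x)" for i x
    unfolding G_def[abs_def] G'_def[abs_def]
    by (intro bounded_bilinear.FDERIV[OF bounded_bilinear_inner] C1_fun_frechet_derivative(1)[OF s]
        bounded_linear.has_derivative[OF matrix_vector_mul_bounded_linear] C1_fun_frechet_derivative(1)[OF w])
  have cont: "continuous_on UNIV (\<lambda>x. G' i x h)" for i h
    unfolding G'_def by (intro continuous_intros c cm)
  have "vol_inner D (\<lambda>x. \<Sum>i\<in>UNIV. Amat i *v partial i w x) s +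
      vol_inner D (\<lambda>x. \<Sum>i\<in>UNIV. transpose (Amat i) *v partial i s x) w
    = (LINT x:D|lebesgue. (\<Sum>i\<in>UNIV. Amat i *v partial i w x) \<bullet> s x
        + (\<Sum>i\<in>UNIV. transpose (Amat i) *v partial i s x) \<bullet> w x)"
    unfolding vol_inner_def
    by (rule set_integral_add(2)[symmetric];
        intro set_integrable_continuous three_simplex_props(1)[OF D];
        unfold partial_def; intro continuous_intros c cm)
  also have "\<dots> = (LINT x:D|lebesgue. \<Sum>i\<in>UNIV. G' i x (axis i 1))"
  proof -
    have "(\<Sum>i\<in>UNIV. Amat i *v partial i w x) \<bullet> s x
        + (\<Sum>i\<in>UNIV. transpose (Amat i) *v partial i s x) \<bullet> w x = (\<Sum>i\<in>UNIV. G' i x (axis i 1))" for x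
    proof -
      have "(transpose (Amat i) *v partial i s x) \<bullet> w x = (Amat i *v w x) \<bullet> partial i s x" for i
        by (metis matrix_vector_adjoint inner_commute)
      then show ?thesis
        by (simp only: inner_sum_left G'_def partial_def sum.distrib add.commute)
    qed
    then show ?thesis by simp
  qed
  also have "\<dots> = (\<Sum>F | F facet_of D. face_integral F (\<lambda>x. \<Sum>i\<in>UNIV. outward_normal D F $ i * G i x))"
    by (rule divergence_simplex[OF D der cont])
  also have "\<dots> = (\<Sum>F | F facet_of D. face_integral F (\<lambda>x. (An (outward_normal D F) *v w x) \<bullet> s x))"
    by (simp add: An_mult_vector G_def inner_sum_left)
  finally show ?thesis .
qed

text \<open>All that the element \<open>D\<close> contributes on \<open>F\<close> once the equations
  are tested with the solution: the term left by the divergence theorem and the two numerical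
  fluxes.\<close>

definition face_density ::
  "point set set \<Rightarrow> point set set \<Rightarrow> point set set \<Rightarrow> (point set \<Rightarrow> real) \<Rightarrow> (point set \<Rightarrow> real) \<Rightarrow>
   (real^state_index) broken \<Rightarrow> (real^3) broken \<Rightarrow> point set \<Rightarrow> point set \<Rightarrow> point \<Rightarrow> real" where
  "face_density \<T> \<Gamma>s \<Gamma>abc \<alpha>s \<alpha>v \<sigma> v D F x =
     (An (outward_normal D F) *v v D x) \<bullet> \<sigma> D x
     + flux_sigma \<T> \<Gamma>s \<Gamma>abc \<alpha>s \<sigma> v D F x \<bullet> \<sigma> D x
     + flux_v \<T> \<Gamma>s \<Gamma>abc \<alpha>v \<sigma> v D F x \<bullet> v D x"

text \<open>The prescribed factor -2 makes the central part of \<open>flux_v\<close> cancel the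
  whole divergence term, and it turns the penalty weight \<open>\<alpha>s F / 2\<close> into
  \<open>\<alpha>s F\<close>. The velocity jump is zero, so no velocity penalty remains.\<close>

lemma face_density_free_surface:
  assumes "F \<in> \<Gamma>s"
  shows "face_density \<T> \<Gamma>s \<Gamma>abc \<alpha>s \<alpha>v \<sigma> v D F x =
    - (\<alpha>s F * (norm (transpose (An (outward_normal D F)) *v \<sigma> D x))\<^sup>2)"
proof -
  define B where "B = An (outward_normal D F)"
  define p where "p = transpose B *v \<sigma> D x"
  have Bp: "(B *v y) \<bullet> \<sigma> D x = y \<bullet> p" for y by (simp add: matrix_vector_adjoint p_def)
  show ?thesis
    using assms
    unfolding face_density_def flux_sigma_def flux_v_def jump_An_sigma_def jump_v_def Let_def
      B_def[symmetric] p_def[symmetric] inner_add_left inner_scaleR_left Bp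
    by (simp add: power2_norm_eq_inner inner_commute algebra_simps)
qed

text \<open>Each central flux cancels one half of the divergence term
  \<open>v D x \<bullet> p\<close>; the penalties keep their factor 1/2.\<close>

lemma face_density_absorbing:
  assumes "F \<notin> \<Gamma>s" "F \<in> \<Gamma>abc"
  shows "face_density \<T> \<Gamma>s \<Gamma>abc \<alpha>s \<alpha>v \<sigma> v D F x =
    - (\<alpha>s F / 2 * (norm (transpose (An (outward_normal D F)) *v \<sigma> D x))\<^sup>2
       + \<alpha>v F / 2 * (norm (An (outward_normal D F) *v v D x))\<^sup>2)"
proof -
  define B where "B = An (outward_normal D F)"
  define p where "p = transpose B *v \<sigma> D x"
  define q where "q = B *v v D x"
  have Bp: "(B *v y) \<bullet> \<sigma> D x = y \<bullet> p" for y by (simp add: matrix_vector_adjoint p_def)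
  have Bq: "(transpose B *v y) \<bullet> v D x = y \<bullet> q" for y
    using matrix_vector_adjoint[of "transpose B" y] by (simp add: q_def transpose_transpose)
  have neg: "B *v (- y) = - (B *v y)" for y by (simp add: linear_neg[OF matrix_vector_mul_linear])
  show ?thesis
    using assms Bp[of "v D x"]
    unfolding face_density_def flux_sigma_def flux_v_def jump_An_sigma_def jump_v_def Let_def
      B_def[symmetric] p_def[symmetric] inner_add_left inner_scaleR_left Bp Bq
    by (simp add: neg q_def[symmetric] power2_norm_eq_inner inner_commute algebra_simps)
qed

lemma face_density_interior:
  assumes "F \<notin> \<Gamma>s" "F \<notin> \<Gamma>abc"
    and nb: "neighbor \<T> D F = D'" "neighbor \<T> D' F = D"
    and n: "outward_normal D' F = - outward_normal D F"
  shows "face_density \<T> \<Gamma>s \<Gamma>abc \<alpha>s \<alpha>v \<sigma> v D F x + face_density \<T> \<Gamma>s \<Gamma>abc \<alpha>s \<alpha>v \<sigma> v D' F x =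
    - (\<alpha>s F / 2 * (norm (transpose (An (outward_normal D F)) *v jump \<T> \<sigma> D F x))\<^sup>2
       + \<alpha>v F / 2 * (norm (An (outward_normal D F) *v jump \<T> v D F x))\<^sup>2)"
proof -
  define B where "B = An (outward_normal D F)"
  define s where "s = \<sigma> D x"
  define s' where "s' = \<sigma> D' x"
  define w where "w = v D x"
  define w' where "w' = v D' x"
  define p where "p = transpose B *v s"
  define p' where "p' = transpose B *v s'"
  define q where "q = B *v w"
  define q' where "q' = B *v w'"
  have B': "An (- outward_normal D F) = - B" by (simp add: An_uminus B_def)
  have tneg: "transpose (- B) = - transpose B" by (simp add: transpose_def vec_eq_iff)
  have mneg: "(- C) *v y = - (C *v y)" for C :: "real^'i^'j" and y
    by (simp add: vec_eq_iff matrix_vector_mult_def sum_negf)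
  have Bp: "(B *v y) \<bullet> s = y \<bullet> p" "(B *v y) \<bullet> s' = y \<bullet> p'" for y
    by (simp_all add: matrix_vector_adjoint p_def p'_def)
  have Bq: "(transpose B *v y) \<bullet> w = y \<bullet> q" "(transpose B *v y) \<bullet> w' = y \<bullet> q'" for y
    using matrix_vector_adjoint[of "transpose B" y] by (simp_all add: q_def q'_def transpose_transpose)
  have dp: "transpose B *v (s' - s) = p' - p" "transpose B *v (s - s') = p - p'"
    and dq: "B *v (w' - w) = q' - q" "B *v (w - w') = q - q'"
    by (simp_all add: p_def p'_def q_def q'_def matrix_vector_mult_diff_distrib)
  \<comment> \<open>Adjointness brings all mixed products to the form of some \<open>q\<close> times
    some \<open>s\<close>. The nonpenalty part seen from \<open>D\<close> then reduces to half of
    \<open>q \<bullet> s' + q' \<bullet> s\<close>, and that from \<open>D'\<close> to its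
    negative.\<close>
  have cross: "p \<bullet> w = q \<bullet> s" "p' \<bullet> w = q \<bullet> s'" "p \<bullet> w' = q' \<bullet> s" "p' \<bullet> w' = q' \<bullet> s'"
    unfolding p_def p'_def Bq by (rule inner_commute)+
  have fD: "face_density \<T> \<Gamma>s \<Gamma>abc \<alpha>s \<alpha>v \<sigma> v D F x =
     q \<bullet> s + (1/2 * ((q' - q) \<bullet> s) + \<alpha>s F / 2 * ((p' - p) \<bullet> p))
     + (1/2 * ((p' - p) \<bullet> w) + \<alpha>v F / 2 * ((q' - q) \<bullet> q))"
    using assms(1,2)
    unfolding face_density_def flux_sigma_def flux_v_def jump_An_sigma_def jump_v_def Let_def jump_def
      nb B_def[symmetric] s_def[symmetric] s'_def[symmetric] w_def[symmetric] w'_def[symmetric]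
    by (simp add: dp dq inner_add_left Bp Bq q_def[symmetric] del: transpose_matrix_vector)
  have fD': "face_density \<T> \<Gamma>s \<Gamma>abc \<alpha>s \<alpha>v \<sigma> v D' F x =
     - (q' \<bullet> s') + (1/2 * (- ((q - q') \<bullet> s')) + \<alpha>s F / 2 * ((p - p') \<bullet> p'))
     + (1/2 * (- ((p - p') \<bullet> w')) + \<alpha>v F / 2 * ((q - q') \<bullet> q'))"
    using assms(1,2)
    unfolding face_density_def flux_sigma_def flux_v_def jump_An_sigma_def jump_v_def Let_def jump_def
      nb n B' tneg mneg s_def[symmetric] s'_def[symmetric] w_def[symmetric] w'_def[symmetric]
    by (simp add: dp dq inner_add_left inner_diff_left right_diff_distrib diff_divide_distrib
        Bp Bq q'_def[symmetric] linear_neg[OF matrix_vector_mul_linear]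
        del: transpose_matrix_vector)
  have j: "transpose (An (outward_normal D F)) *v jump \<T> \<sigma> D F x = p' - p"
    "An (outward_normal D F) *v jump \<T> v D F x = q' - q"
    unfolding jump_def nb B_def[symmetric] using dp dq by (simp_all add: s_def s'_def w_def w'_def)
  show ?thesis
    unfolding fD fD' j power2_norm_eq_inner
    by (simp add: inner_diff_left inner_diff_right cross inner_commute algebra_simps)
qed

lemma neighbor_eqI:
  assumes "{D \<in> \<T>. F facet_of D} = {D, D'}" "D \<noteq> D'"
  shows "neighbor \<T> D F = D'"
  unfolding neighbor_def
proof (rule the_equality)
  show "D' \<in> \<T> \<and> D' \<noteq> D \<and> F facet_of D'" using assms by blast
  fix E assume "E \<in> \<T> \<and> E \<noteq> D \<and> F facet_of E"
  then have "E \<in> {D \<in> \<T>. F facet_of D}" "E \<noteq> D" by auto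
  then show "E = D'" unfolding assms(1) by simp
qed

text \<open>A neighbor in the mesh is asked for only off the prescribed faces: on those,
  \<open>neighbor\<close> describes no element, and the jumps do not refer to it.\<close>

lemma continuous_on_fluxes:
  assumes "F \<notin> \<Gamma>s \<union> \<Gamma>abc \<Longrightarrow> neighbor \<T> D F \<in> \<T>" and "D \<in> \<T>"
    and \<sigma>: "\<And>D. D \<in> \<T> \<Longrightarrow> continuous_on UNIV (\<sigma> D)"
    and v: "\<And>D. D \<in> \<T> \<Longrightarrow> continuous_on UNIV (v D)"
  shows "continuous_on UNIV (flux_sigma \<T> \<Gamma>s \<Gamma>abc \<alpha>s \<sigma> v D F)"
    and "continuous_on UNIV (flux_v \<T> \<Gamma>s \<Gamma>abc \<alpha>v \<sigma> v D F)"
proof -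
  note cm = bounded_linear.continuous_on[OF matrix_vector_mul_bounded_linear]
  have j1: "continuous_on UNIV (jump_An_sigma \<T> \<Gamma>s \<Gamma>abc \<sigma> D F)"
    using assms unfolding jump_An_sigma_def Let_def jump_def
    by (cases "F \<in> \<Gamma>s"; cases "F \<in> \<Gamma>abc") (auto intro!: continuous_intros cm simp del: transpose_matrix_vector)
  have j2: "continuous_on UNIV (jump_v \<T> \<Gamma>s \<Gamma>abc v D F)"
    using assms unfolding jump_v_def jump_def
    by (cases "F \<in> \<Gamma>s"; cases "F \<in> \<Gamma>abc") (auto intro!: continuous_intros)
  show "continuous_on UNIV (flux_sigma \<T> \<Gamma>s \<Gamma>abc \<alpha>s \<sigma> v D F)"
    and "continuous_on UNIV (flux_v \<T> \<Gamma>s \<Gamma>abc \<alpha>v \<sigma> v D F)"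
    unfolding flux_sigma_def[abs_def] flux_v_def[abs_def] by (intro continuous_intros cm j1 j2)+
qed

theorem theorem1:
  fixes \<Omega> :: "point set" and \<T> :: "point set set" and N :: nat
    and Cp :: "point \<Rightarrow> real^6^6" and \<rho> :: "point \<Rightarrow> real"
    and S :: "point \<Rightarrow> real^state_index^state_index"
    and \<Gamma>s \<Gamma>abc :: "point set set" and \<alpha>s \<alpha>v :: "point set \<Rightarrow> real"
    and J :: "real set"
    and \<sigma> :: "real \<Rightarrow> (real^state_index) broken" and v :: "real \<Rightarrow> (real^3) broken"
    and own :: "point set \<Rightarrow> point set"
  assumes domain: "open \<Omega>" "connected \<Omega>" "\<Omega> \<noteq> {}"
    and mesh: "tetrahedral_mesh \<Omega> \<T>"
    and coefficients: "admissible_coefficients \<Omega> Cp \<rho> S"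
    and boundary: "\<Gamma>s \<union> \<Gamma>abc = boundary_faces \<Omega> \<T>" "\<Gamma>s \<inter> \<Gamma>abc = {}"
    and penalty: "\<And>F. F \<in> mesh_faces \<T> \<Longrightarrow> \<alpha>s F \<ge> 0 \<and> \<alpha>v F \<ge> 0"
    and time: "is_interval J" "interior J \<noteq> {}"
    and \<sigma>_Vh: "\<And>t. t \<in> J \<Longrightarrow> \<sigma> t \<in> Vh N \<T>"
    and v_Vh: "\<And>t. t \<in> J \<Longrightarrow> v t \<in> Vh N \<T>"
    and C1: "C1_in_time J \<T> \<sigma>" "C1_in_time J \<T> v"
    and eq_\<sigma>: "\<And>t h. t \<in> J \<Longrightarrow> h \<in> Vh N \<T> \<Longrightarrow>
      (\<Sum>D\<in>\<T>. vol_inner D (\<lambda>x. Qs_inv (Cp x) *v time_deriv J \<sigma> t D x) (h D)) =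
      (\<Sum>D\<in>\<T>. vol_inner D (\<lambda>x. \<Sum>i\<in>UNIV. Amat i *v partial i (v t D) x) (h D)
              + bdry_inner D (flux_sigma \<T> \<Gamma>s \<Gamma>abc \<alpha>s (\<sigma> t) (v t) D) (h D)
              + vol_inner D (\<lambda>x. S x *v \<sigma> t D x) (h D))"
    and eq_v: "\<And>t g. t \<in> J \<Longrightarrow> g \<in> Vh N \<T> \<Longrightarrow>
      (\<Sum>D\<in>\<T>. vol_inner D (\<lambda>x. \<rho> x *\<^sub>R time_deriv J v t D x) (g D)) =
      (\<Sum>D\<in>\<T>. vol_inner D (\<lambda>x. \<Sum>i\<in>UNIV. transpose (Amat i) *v partial i (\<sigma> t D) x) (g D)
              + bdry_inner D (flux_v \<T> \<Gamma>s \<Gamma>abc \<alpha>v (\<sigma> t) (v t) D) (g D))"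
    and own: "\<And>F. F \<in> mesh_faces \<T> \<Longrightarrow> own F \<in> \<T> \<and> F facet_of own F"
  defines "energy \<equiv> \<lambda>D t. vol_inner D (\<lambda>x. Qs_inv (Cp x) *v \<sigma> t D x) (\<sigma> t D)
                         + vol_inner D (\<lambda>x. \<rho> x *\<^sub>R v t D x) (v t D)"
    and "A \<equiv> \<lambda>F. An (outward_normal (own F) F)"
  defines "rate \<equiv> \<lambda>t.
      - (\<Sum>F\<in>mesh_faces \<T> - boundary_faces \<Omega> \<T>. face_integral F (\<lambda>x.
           \<alpha>s F / 2 * (norm (transpose (A F) *v jump \<T> (\<sigma> t) (own F) F x))\<^sup>2
         + \<alpha>v F / 2 * (norm (A F *v jump \<T> (v t) (own F) F x))\<^sup>2))
      - (\<Sum>F\<in>\<Gamma>s. face_integral F (\<lambda>x.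
           \<alpha>s F * (norm (transpose (A F) *v \<sigma> t (own F) x))\<^sup>2))
      - (\<Sum>F\<in>\<Gamma>abc. face_integral F (\<lambda>x.
           \<alpha>s F / 2 * (norm (transpose (A F) *v \<sigma> t (own F) x))\<^sup>2
         + \<alpha>v F / 2 * (norm (A F *v v t (own F) x))\<^sup>2))
      + (\<Sum>D\<in>\<T>. LINT x:D|lebesgue. \<sigma> t D x \<bullet> (S x *v \<sigma> t D x))"
  shows "\<forall>t\<in>J. (\<forall>D\<in>\<T>. energy D differentiable at t within J) \<and>
           (\<Sum>D\<in>\<T>. 1/2 * vector_derivative (energy D) (at t within J)) = rate t \<and>
           rate t \<le> 0"
proof
  fix t assume t: "t \<in> J"
  note coeff = admissible_coefficients_consequences[OF coefficients]
  have fin: "finite \<T>" and simplex: "\<And>D. D \<in> \<T> \<Longrightarrow> 3 simplex D"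
    and inside: "\<And>D. D \<in> \<T> \<Longrightarrow> interior D \<subseteq> \<Omega>"
    and disj: "\<And>D D'. D \<in> \<T> \<Longrightarrow> D' \<in> \<T> \<Longrightarrow> D \<noteq> D' \<Longrightarrow> interior D \<inter> interior D' = {}"
    and card: "\<And>F. F \<in> mesh_faces \<T> \<Longrightarrow>
      card {D \<in> \<T>. F facet_of D} = (if F \<subseteq> frontier \<Omega> then 1 else 2)"
    using mesh unfolding tetrahedral_mesh_def by auto
  \<comment> \<open>An interval with interior points has no isolated point, so derivatives within
    \<open>J\<close> are unique even at an endpoint that belongs to \<open>J\<close>.\<close>
  have nontrivial: "at t within J \<noteq> bot"
  proof -
    have "J \<noteq> {t}" using time(2) by auto
    then have "t islimpt J"
      using connected_imp_perfect[of J t] time(1) t is_interval_connected by blast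
    then show ?thesis by (simp add: trivial_limit_within)
  qed
  have C1\<sigma>: "C1_fun (\<sigma> t D)" and C1v: "C1_fun (v t D)" if "D \<in> \<T>" for D
    using C1_fun_Vh[OF \<sigma>_Vh[OF t] that] C1_fun_Vh[OF v_Vh[OF t] that] .
  note c\<sigma> = C1_fun_continuous_on[OF C1\<sigma>] and cv = C1_fun_continuous_on[OF C1v]

  \<comment> \<open>Derivative of the energy on each element\<close>
  let ?\<rho> = "\<lambda>x. mat (\<rho> x) :: real^3^3"
  define E' where "E' D = 2 * vol_inner D (\<lambda>x. Qs_inv (Cp x) *v time_deriv J \<sigma> t D x) (\<sigma> t D)
    + 2 * vol_inner D (\<lambda>x. \<rho> x *\<^sub>R time_deriv J v t D x) (v t D)" for D
  have energy: "(energy D has_vector_derivative E' D) (at t within J)" if D: "D \<in> \<T>" for D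
  proof -
    have sym\<rho>: "transpose (?\<rho> x) = ?\<rho> x" for x by (simp add: transpose_mat)
    note geo = simplex[OF D] inside[OF D]
    have "((\<lambda>s. vol_inner D (\<lambda>x. Qs_inv (Cp x) *v \<sigma> s D x) (\<sigma> s D)) has_vector_derivative
        2 * vol_inner D (\<lambda>x. Qs_inv (Cp x) *v time_deriv J \<sigma> t D x) (\<sigma> t D)) (at t within J)"
      by (rule energy_has_vector_derivative[OF three_simplex_props(1)[OF geo(1)] D
            bounded_coefficient_integrable[OF geo coeff(1)] vol_inner_symmetric[OF geo coeff(1,2)]
            \<sigma>_Vh C1(1) t nontrivial])
    moreover have "((\<lambda>s. vol_inner D (\<lambda>x. ?\<rho> x *v v s D x) (v s D)) has_vector_derivative
        2 * vol_inner D (\<lambda>x. ?\<rho> x *v time_deriv J v t D x) (v t D)) (at t within J)"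
      by (rule energy_has_vector_derivative[OF three_simplex_props(1)[OF geo(1)] D
            bounded_coefficient_integrable[OF geo coeff(3)] vol_inner_symmetric[OF geo coeff(3) sym\<rho>]
            v_Vh C1(2) t nontrivial])
    ultimately show ?thesis
      unfolding energy_def E'_def mat_mult_vector by (rule has_vector_derivative_add)
  qed

  \<comment> \<open>Faces, their adjacent elements and continuity of the face terms\<close>
  let ?H = "face_density \<T> \<Gamma>s \<Gamma>abc \<alpha>s \<alpha>v (\<sigma> t) (v t)"
  define I where "I = mesh_faces \<T> - boundary_faces \<Omega> \<T>"
  have faces: "mesh_faces \<T> = I \<union> (\<Gamma>s \<union> \<Gamma>abc)" "I \<inter> (\<Gamma>s \<union> \<Gamma>abc) = {}"
    unfolding boundary(1) I_def by (auto simp: boundary_faces_def)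
  have finF: "finite (mesh_faces \<T>)"
  proof -
    have "mesh_faces \<T> = (\<Union>D\<in>\<T>. {F. F facet_of D})" by (auto simp: mesh_faces_def)
    moreover have "finite {F. F facet_of D}" if D\<T>: "D \<in> \<T>" for D
    proof -
      obtain a b c d where t: "tetra a b c d" and D: "D = convex hull {a, b, c, d}"
        using three_simplex_tetra[OF simplex[OF D\<T>]] by blast
      have "{F. F facet_of D} \<subseteq> {convex hull {b, c, d}, convex hull {a, c, d}, convex hull {a, b, d}, convex hull {a, b, c}}"
        using facet_of_tetra[OF t] unfolding D by blast
      then show ?thesis by (rule finite_subset) simp
    qed
    ultimately show ?thesis using fin by simp
  qed
  \<comment> \<open>On a boundary face the owner is forced to be the only adjacent element, so
    traces from \<open>own F\<close> are the interior traces.\<close>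
  have bdry_own: "{D \<in> \<T>. F facet_of D} = {own F}" if "F \<in> \<Gamma>s \<union> \<Gamma>abc" for F
  proof -
    have F: "F \<in> mesh_faces \<T>" "F \<subseteq> frontier \<Omega>" using that unfolding boundary(1) boundary_faces_def by auto
    then have "card {D \<in> \<T>. F facet_of D} = 1" using card by simp
    then obtain D where "{D \<in> \<T>. F facet_of D} = {D}" by (auto simp: card_1_singleton_iff)
    moreover have "own F \<in> {D \<in> \<T>. F facet_of D}" using own[OF F(1)] by simp
    ultimately show ?thesis by simp
  qed
  have interior_pair: "{D \<in> \<T>. F facet_of D} = {D, neighbor \<T> D F}" "neighbor \<T> D F \<noteq> D"
      "neighbor \<T> (neighbor \<T> D F) F = D"
    if "F \<in> I" "D \<in> \<T>" "F facet_of D" for F D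
  proof -
    have "card {D \<in> \<T>. F facet_of D} = 2"
      using card[of F] that unfolding I_def boundary_faces_def by auto
    then obtain X Y where XY: "{D \<in> \<T>. F facet_of D} = {X, Y}" "X \<noteq> Y" by (auto simp: card_2_iff)
    moreover have "D \<in> {D \<in> \<T>. F facet_of D}" using that(2,3) by simp
    ultimately have "D = X \<or> D = Y" by blast
    then obtain D' where D': "{D \<in> \<T>. F facet_of D} = {D, D'}" "D \<noteq> D'"
      using XY by (metis insert_commute)
    then have nb: "neighbor \<T> D F = D'" by (rule neighbor_eqI)
    have "neighbor \<T> D' F = D" using D' by (intro neighbor_eqI) auto
    with D' nb show "{D \<in> \<T>. F facet_of D} = {D, neighbor \<T> D F}" "neighbor \<T> D F \<noteq> D"
      "neighbor \<T> (neighbor \<T> D F) F = D" by auto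
  qed
  have flux_cont: "continuous_on UNIV (flux_sigma \<T> \<Gamma>s \<Gamma>abc \<alpha>s (\<sigma> t) (v t) D F)"
      "continuous_on UNIV (flux_v \<T> \<Gamma>s \<Gamma>abc \<alpha>v (\<sigma> t) (v t) D F)"
    if D: "D \<in> \<T>" "F facet_of D" for D F
  proof -
    have "neighbor \<T> D F \<in> \<T>" if "F \<notin> \<Gamma>s \<union> \<Gamma>abc"
    proof -
      have "F \<in> mesh_faces \<T>" using D by (auto simp: mesh_faces_def)
      then have "F \<in> I" using that faces by blast
      then show ?thesis using interior_pair(1)[OF _ D] by blast
    qed
    then show "continuous_on UNIV (flux_sigma \<T> \<Gamma>s \<Gamma>abc \<alpha>s (\<sigma> t) (v t) D F)"
      "continuous_on UNIV (flux_v \<T> \<Gamma>s \<Gamma>abc \<alpha>v (\<sigma> t) (v t) D F)"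
      using D c\<sigma> cv by (auto intro!: continuous_on_fluxes)
  qed
  have An_cont: "continuous_on UNIV (\<lambda>x. (An n *v v t D x) \<bullet> \<sigma> t D x)" if "D \<in> \<T>" for n D
    by (intro continuous_intros bounded_linear.continuous_on[OF matrix_vector_mul_bounded_linear] c\<sigma> cv that)
  have H_cont: "continuous_on UNIV (?H D F)" if D: "D \<in> \<T>" "F facet_of D" for D F
    unfolding face_density_def[abs_def]
    by (intro continuous_intros An_cont flux_cont c\<sigma> cv D)

  \<comment> \<open>The energy identity\<close>
  let ?S = "\<lambda>D. vol_inner D (\<lambda>x. S x *v \<sigma> t D x) (\<sigma> t D)"
  have "(\<Sum>D\<in>\<T>. 1/2 * E' D) =
      (\<Sum>D\<in>\<T>. vol_inner D (\<lambda>x. Qs_inv (Cp x) *v time_deriv J \<sigma> t D x) (\<sigma> t D))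
      + (\<Sum>D\<in>\<T>. vol_inner D (\<lambda>x. \<rho> x *\<^sub>R time_deriv J v t D x) (v t D))"
    by (simp add: E'_def sum.distrib sum_distrib_left add_divide_distrib)
  also have "\<dots> = (\<Sum>D\<in>\<T>. (vol_inner D (\<lambda>x. \<Sum>i\<in>UNIV. Amat i *v partial i (v t D) x) (\<sigma> t D)
        + vol_inner D (\<lambda>x. \<Sum>i\<in>UNIV. transpose (Amat i) *v partial i (\<sigma> t D) x) (v t D))
      + bdry_inner D (flux_sigma \<T> \<Gamma>s \<Gamma>abc \<alpha>s (\<sigma> t) (v t) D) (\<sigma> t D)
      + bdry_inner D (flux_v \<T> \<Gamma>s \<Gamma>abc \<alpha>v (\<sigma> t) (v t) D) (v t D)) + (\<Sum>D\<in>\<T>. ?S D)"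
    unfolding eq_\<sigma>[OF t \<sigma>_Vh[OF t]] eq_v[OF t v_Vh[OF t]] by (simp only: sum.distrib add_ac)
  also have "(\<Sum>D\<in>\<T>. (vol_inner D (\<lambda>x. \<Sum>i\<in>UNIV. Amat i *v partial i (v t D) x) (\<sigma> t D)
        + vol_inner D (\<lambda>x. \<Sum>i\<in>UNIV. transpose (Amat i) *v partial i (\<sigma> t D) x) (v t D))
      + bdry_inner D (flux_sigma \<T> \<Gamma>s \<Gamma>abc \<alpha>s (\<sigma> t) (v t) D) (\<sigma> t D)
      + bdry_inner D (flux_v \<T> \<Gamma>s \<Gamma>abc \<alpha>v (\<sigma> t) (v t) D) (v t D))
    = (\<Sum>D\<in>\<T>. \<Sum>F | F facet_of D. face_integral F (?H D F))"
  proof (rule sum.cong[OF refl])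
    fix D assume D: "D \<in> \<T>"
    show "(vol_inner D (\<lambda>x. \<Sum>i\<in>UNIV. Amat i *v partial i (v t D) x) (\<sigma> t D)
        + vol_inner D (\<lambda>x. \<Sum>i\<in>UNIV. transpose (Amat i) *v partial i (\<sigma> t D) x) (v t D))
      + bdry_inner D (flux_sigma \<T> \<Gamma>s \<Gamma>abc \<alpha>s (\<sigma> t) (v t) D) (\<sigma> t D)
      + bdry_inner D (flux_v \<T> \<Gamma>s \<Gamma>abc \<alpha>v (\<sigma> t) (v t) D) (v t D)
      = (\<Sum>F | F facet_of D. face_integral F (?H D F))"
      unfolding divergence_An[OF simplex[OF D] C1\<sigma>[OF D] C1v[OF D]] bdry_inner_def sum.distrib[symmetric]
    proof (rule sum.cong[OF refl])
      fix F assume "F \<in> {F. F facet_of D}"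
      then have F: "F facet_of D" by simp
      note c = An_cont[OF D] continuous_on_inner[OF flux_cont(1)[OF D F] c\<sigma>[OF D]]
        continuous_on_inner[OF flux_cont(2)[OF D F] cv[OF D]]
      show "face_integral F (\<lambda>x. (An (outward_normal D F) *v v t D x) \<bullet> \<sigma> t D x)
         + face_integral F (\<lambda>x. flux_sigma \<T> \<Gamma>s \<Gamma>abc \<alpha>s (\<sigma> t) (v t) D F x \<bullet> \<sigma> t D x)
         + face_integral F (\<lambda>x. flux_v \<T> \<Gamma>s \<Gamma>abc \<alpha>v (\<sigma> t) (v t) D F x \<bullet> v t D x)
         = face_integral F (?H D F)"
        unfolding face_density_def[abs_def] face_integral_add[OF continuous_on_add[OF c(1,2)] c(3)]
          face_integral_add[OF c(1,2)] ..
    qed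
  qed
  \<comment> \<open>Exchanging the summations collects the contributions of all elements adjacent to
    a face, one on the boundary and two in the interior.\<close>
  also have "\<dots> = (\<Sum>F\<in>mesh_faces \<T>. \<Sum>D | D \<in> \<T> \<and> F facet_of D. face_integral F (?H D F))"
  proof -
    have "{F. F facet_of D} = {F \<in> mesh_faces \<T>. F facet_of D}" if "D \<in> \<T>" for D
      using that by (auto simp: mesh_faces_def)
    then have "(\<Sum>D\<in>\<T>. \<Sum>F | F facet_of D. face_integral F (?H D F))
        = (\<Sum>D\<in>\<T>. \<Sum>F | F \<in> mesh_faces \<T> \<and> F facet_of D. face_integral F (?H D F))"
      by (intro sum.cong) auto
    also have "\<dots> = (\<Sum>F\<in>mesh_faces \<T>. \<Sum>D | D \<in> \<T> \<and> F facet_of D. face_integral F (?H D F))"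
      by (rule sum.swap_restrict[OF fin finF])
    finally show ?thesis .
  qed
  also have "\<dots> = (\<Sum>F\<in>I. \<Sum>D | D \<in> \<T> \<and> F facet_of D. face_integral F (?H D F))
      + ((\<Sum>F\<in>\<Gamma>s. \<Sum>D | D \<in> \<T> \<and> F facet_of D. face_integral F (?H D F))
       + (\<Sum>F\<in>\<Gamma>abc. \<Sum>D | D \<in> \<T> \<and> F facet_of D. face_integral F (?H D F)))"
    using finF faces boundary(2) unfolding faces(1) by (simp add: sum.union_disjoint)
  also have "(\<Sum>F\<in>I. \<Sum>D | D \<in> \<T> \<and> F facet_of D. face_integral F (?H D F)) =
      - (\<Sum>F\<in>I. face_integral F (\<lambda>x.
           \<alpha>s F / 2 * (norm (transpose (A F) *v jump \<T> (\<sigma> t) (own F) F x))\<^sup>2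
         + \<alpha>v F / 2 * (norm (A F *v jump \<T> (v t) (own F) F x))\<^sup>2))"
    unfolding sum_negf[symmetric]
  proof (rule sum.cong[OF refl])
    fix F assume F: "F \<in> I"
    \<comment> \<open>The owner only fixes an orientation: the sum over both sides is evaluated with
      its normal and its jumps, whichever of the two elements it is.\<close>
    define D D' where "D = own F" and "D' = neighbor \<T> (own F) F"
    have D: "D \<in> \<T>" "F facet_of D" using own[of F] F unfolding I_def D_def by auto
    note pair = interior_pair[OF F D]
    have D': "D' \<in> \<T>" "F facet_of D'" using pair(1) unfolding D'_def D_def by auto
    have neq: "D \<noteq> D'" using pair(2) by (auto simp: D_def D'_def)
    have n: "outward_normal D' F = - outward_normal D F"
      using outward_normal_opposite[OF simplex[OF D(1)] D(2) simplex[OF D'(1)] D'(2) disj[OF D(1) D'(1) neq]] .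
    have nF: "F \<notin> \<Gamma>s" "F \<notin> \<Gamma>abc" using F faces(2) by auto
    have set: "{D. D \<in> \<T> \<and> F facet_of D} = {D, D'}" using pair(1) by (simp add: D_def D'_def)
    have nb: "neighbor \<T> D F = D'" "neighbor \<T> D' F = D" using pair(3) by (simp_all add: D_def D'_def)
    have "(\<Sum>D | D \<in> \<T> \<and> F facet_of D. face_integral F (?H D F)) = face_integral F (?H D F) + face_integral F (?H D' F)"
      unfolding set using neq by simp
    also have "\<dots> = face_integral F (\<lambda>x. ?H D F x + ?H D' F x)"
      by (rule face_integral_add[symmetric]) (intro H_cont D D')+
    also have "\<dots> = - face_integral F (\<lambda>x.
           \<alpha>s F / 2 * (norm (transpose (A F) *v jump \<T> (\<sigma> t) (own F) F x))\<^sup>2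
         + \<alpha>v F / 2 * (norm (A F *v jump \<T> (v t) (own F) F x))\<^sup>2)"
      unfolding face_density_interior[OF nF nb n] face_integral_minus A_def D_def[symmetric] ..
    finally show "(\<Sum>D | D \<in> \<T> \<and> F facet_of D. face_integral F (?H D F)) = \<dots>" .
  qed
  also have "(\<Sum>F\<in>\<Gamma>s. \<Sum>D | D \<in> \<T> \<and> F facet_of D. face_integral F (?H D F)) =
      - (\<Sum>F\<in>\<Gamma>s. face_integral F (\<lambda>x. \<alpha>s F * (norm (transpose (A F) *v \<sigma> t (own F) x))\<^sup>2))"
    unfolding sum_negf[symmetric]
  proof (rule sum.cong[OF refl])
    fix F assume F: "F \<in> \<Gamma>s"
    have set: "{D. D \<in> \<T> \<and> F facet_of D} = {own F}" using bdry_own F by blast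
    show "(\<Sum>D | D \<in> \<T> \<and> F facet_of D. face_integral F (?H D F)) =
      - face_integral F (\<lambda>x. \<alpha>s F * (norm (transpose (A F) *v \<sigma> t (own F) x))\<^sup>2)"
      unfolding set face_integral_minus[symmetric] A_def
      by (simp add: face_density_free_surface[OF F, abs_def] del: transpose_matrix_vector)
  qed
  also have "(\<Sum>F\<in>\<Gamma>abc. \<Sum>D | D \<in> \<T> \<and> F facet_of D. face_integral F (?H D F)) =
      - (\<Sum>F\<in>\<Gamma>abc. face_integral F (\<lambda>x.
           \<alpha>s F / 2 * (norm (transpose (A F) *v \<sigma> t (own F) x))\<^sup>2
         + \<alpha>v F / 2 * (norm (A F *v v t (own F) x))\<^sup>2))"
    unfolding sum_negf[symmetric]
  proof (rule sum.cong[OF refl])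
    fix F assume F: "F \<in> \<Gamma>abc"
    then have F': "F \<notin> \<Gamma>s" using boundary(2) by blast
    have set: "{D. D \<in> \<T> \<and> F facet_of D} = {own F}" using bdry_own F by blast
    show "(\<Sum>D | D \<in> \<T> \<and> F facet_of D. face_integral F (?H D F)) =
      - face_integral F (\<lambda>x. \<alpha>s F / 2 * (norm (transpose (A F) *v \<sigma> t (own F) x))\<^sup>2
         + \<alpha>v F / 2 * (norm (A F *v v t (own F) x))\<^sup>2)"
      unfolding set face_integral_minus[symmetric] A_def
      by (simp add: face_density_absorbing[OF F' F, abs_def] del: transpose_matrix_vector)
  qed
  also have "(\<Sum>D\<in>\<T>. ?S D) = (\<Sum>D\<in>\<T>. LINT x:D|lebesgue. \<sigma> t D x \<bullet> (S x *v \<sigma> t D x))"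
    by (simp add: vol_inner_def inner_commute)
  finally have identity: "(\<Sum>D\<in>\<T>. 1/2 * E' D) = rate t"
    by (simp add: rate_def I_def)

  \<comment> \<open>Sign of the dissipation rate\<close>
  have "0 \<le> (\<Sum>F\<in>I. face_integral F (\<lambda>x.
           \<alpha>s F / 2 * (norm (transpose (A F) *v jump \<T> (\<sigma> t) (own F) F x))\<^sup>2
         + \<alpha>v F / 2 * (norm (A F *v jump \<T> (v t) (own F) F x))\<^sup>2))"
    using penalty unfolding I_def
    by (intro sum_nonneg face_integral_nonneg add_nonneg_nonneg mult_nonneg_nonneg) auto
  moreover have "0 \<le> (\<Sum>F\<in>\<Gamma>s. face_integral F (\<lambda>x. \<alpha>s F * (norm (transpose (A F) *v \<sigma> t (own F) x))\<^sup>2))"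
    using penalty faces(1) by (intro sum_nonneg face_integral_nonneg mult_nonneg_nonneg) auto
  moreover have "0 \<le> (\<Sum>F\<in>\<Gamma>abc. face_integral F (\<lambda>x.
           \<alpha>s F / 2 * (norm (transpose (A F) *v \<sigma> t (own F) x))\<^sup>2
         + \<alpha>v F / 2 * (norm (A F *v v t (own F) x))\<^sup>2))"
    using penalty faces(1)
    by (intro sum_nonneg face_integral_nonneg add_nonneg_nonneg mult_nonneg_nonneg) auto
  moreover have "(\<Sum>D\<in>\<T>. LINT x:D|lebesgue. \<sigma> t D x \<bullet> (S x *v \<sigma> t D x)) \<le> 0"
  proof (rule sum_nonpos)
    fix D assume D: "D \<in> \<T>"
    have "0 \<le> (\<integral>x. - (indicator D x *\<^sub>R (\<sigma> t D x \<bullet> (S x *v \<sigma> t D x))) \<partial>lebesgue)"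
    proof (rule integral_nonneg_AE)
      \<comment> \<open>Negative semi-definiteness is known on \<open>\<Omega>\<close> only; a point
        of \<open>D\<close> off the frontier is interior and therefore in
        \<open>\<Omega>\<close>.\<close>
      show "AE x in lebesgue. 0 \<le> - (indicator D x *\<^sub>R (\<sigma> t D x \<bullet> (S x *v \<sigma> t D x)))"
        using AE_not_frontier_convex[OF three_simplex_props(2)[OF simplex[OF D]]]
      proof eventually_elim
        case (elim x)
        then have "x \<in> D \<Longrightarrow> x \<in> \<Omega>" using inside[OF D] closure_subset[of D] by (auto simp: frontier_def)
        then show ?case using coeff(5)[of x] by (auto simp: indicator_def)
      qed
    qed
    then show "(LINT x:D|lebesgue. \<sigma> t D x \<bullet> (S x *v \<sigma> t D x)) \<le> 0"
      by (simp add: set_lebesgue_integral_def)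
  qed
  ultimately have "rate t \<le> 0" unfolding rate_def I_def[symmetric] by linarith
  moreover have "\<forall>D\<in>\<T>. energy D differentiable at t within J"
    using energy differentiableI_vector by blast
  moreover have "(\<Sum>D\<in>\<T>. 1/2 * vector_derivative (energy D) (at t within J)) = (\<Sum>D\<in>\<T>. 1/2 * E' D)"
    using vector_derivative_within[OF nontrivial energy] by (intro sum.cong) auto
  ultimately show "(\<forall>D\<in>\<T>. energy D differentiable at t within J) \<and>
      (\<Sum>D\<in>\<T>. 1/2 * vector_derivative (energy D) (at t within J)) = rate t \<and> rate t \<le> 0"
    using identity by simp
qed

end
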